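(* Let $k$ be a field of characteristic different from $2$ containing a square root of $-1$, and let $q$ be an anisotropic quadratic form over $k$ with $q\simeq\langle a,b,ab,c,d,cd\rangle$ for some $a,b,c,d\in k^\times$ (so $q$ equals $\langle\langle a,b\rangle\rangle+\langle\langle c,d\rangle\rangle$ in $W(k)$). Let $D=(a,b)_k\otimes(c,d)_k$ and let $\sigma$ be the orthogonal involution on $D$ that is the tensor product of the canonical (conjugation) involutions of $(a,b)_k$ and $(c,d)_k$. Then for $\lambda\in k^\times$, we have $\mathrm{Pf}_2(\langle\lambda\rangle q)=2$ if and only if \[ \lambda^2=\mathrm{Nrd}_D(u)\quad\text{for some } u\in\mathrm{Sym}(D,\sigma). \]
   Context: $(a,b)_k$ denotes the quaternion algebra over $k$ with generators $i,j$, $i^2=a$, $j^2=b$, $ij=-ji$. $\mathrm{Nrd}_D$ is the reduced norm of $D$, and $\mathrm{Sym}(D,\sigma)=\{x\in D\mid\sigma(x)=x\}$. A $2$-fold Pfister form is $\langle\langle x,y\rangle\rangle=\langle 1,x,y,xy\rangle$; for a form $\varphi$ in $I^2(k)$ (the square of the fundamental ideal of the Witt ring $W(k)$), $\mathrm{Pf}_2(\varphi)$ is the least number of $2$-fold Pfister forms whose sum in $W(k)$ equals the Witt class of $\varphi$. *)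

theory Defs
  imports "Jordan_Normal_Form.Char_Poly"
begin

definition qf_val :: "'a::field list \<Rightarrow> (nat \<Rightarrow> 'a) \<Rightarrow> 'a" where
  "qf_val phi v = (\<Sum>i<length phi. phi ! i * (v i)^2)"

definition anisotropic :: "'a::field list \<Rightarrow> bool" where
  "anisotropic phi \<longleftrightarrow> (\<forall>v. qf_val phi v = 0 \<longrightarrow> (\<forall>i<length phi. v i = 0))"

definition gram :: "'a::field list \<Rightarrow> 'a mat" where
  "gram phi = mat (length phi) (length phi) (\<lambda>(i,j). if i = j then phi ! i else 0)"

text \<open>Isometry of quadratic forms (char k \<noteq> 2): congruence of Gram matrices.\<close>
definition qf_isometric :: "'a::field list \<Rightarrow> 'a list \<Rightarrow> bool" where
  "qf_isometric phi psi \<longleftrightarrow> length phi = length psi \<and>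
     (\<exists>T \<in> carrier_mat (length phi) (length phi). invertible_mat T \<and>
        transpose_mat T * gram phi * T = gram psi)"

definition hyp :: "nat \<Rightarrow> 'a::field list" where
  "hyp m = concat (replicate m [1, -1])"

definition witt_equiv :: "'a::field list \<Rightarrow> 'a list \<Rightarrow> bool" where
  "witt_equiv phi psi \<longleftrightarrow> (\<exists>m n. qf_isometric (phi @ hyp m) (psi @ hyp n))"

definition pfister2 :: "'a::field \<Rightarrow> 'a \<Rightarrow> 'a list" where
  "pfister2 x y = [1, x, y, x * y]"

definition Pf2 :: "'a::field list \<Rightarrow> nat" where
  "Pf2 phi = (LEAST n. \<exists>ps. length ps = n \<and> (\<forall>(x,y)\<in>set ps. x \<noteq> 0 \<and> y \<noteq> 0) \<and>
                 witt_equiv phi (concat (map (\<lambda>(x,y). pfister2 x y) ps)))"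

definition scale_qf :: "'a::field \<Rightarrow> 'a list \<Rightarrow> 'a list" where
  "scale_qf l phi = map (\<lambda>x. l * x) phi"

text \<open>Basis of (a,b)_k indexed 0,1,2,3 = 1, i, j, ij. qbasis a b s t = (c, r) means e_s e_t = c e_r.\<close>
definition qbasis :: "'a::field \<Rightarrow> 'a \<Rightarrow> nat \<Rightarrow> nat \<Rightarrow> 'a \<times> nat" where
  "qbasis a b s t =
    (if s = 0 then (1, t)
     else if t = 0 then (1, s)
     else if s = 1 \<and> t = 1 then (a, 0)
     else if s = 1 \<and> t = 2 then (1, 3)
     else if s = 1 \<and> t = 3 then (a, 2)
     else if s = 2 \<and> t = 1 then (-1, 3)
     else if s = 2 \<and> t = 2 then (b, 0)
     else if s = 2 \<and> t = 3 then (-b, 1)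
     else if s = 3 \<and> t = 1 then (-a, 2)
     else if s = 3 \<and> t = 2 then (b, 1)
     else (-(a*b), 0))"

text \<open>Elements of D = (a,b)_k \<otimes> (c,d)_k are coordinate functions on the basis
  e_s \<otimes> f_t, stored at index 4*s+t (s,t < 4); coordinates at indices \<ge> 16 are 0.\<close>
definition bq_carrier :: "(nat \<Rightarrow> 'a::field) set" where
  "bq_carrier = {x. \<forall>m\<ge>16. x m = 0}"

definition bq_mult :: "'a::field \<Rightarrow> 'a \<Rightarrow> 'a \<Rightarrow> 'a \<Rightarrow> (nat \<Rightarrow> 'a) \<Rightarrow> (nat \<Rightarrow> 'a) \<Rightarrow> nat \<Rightarrow> 'a" where
  "bq_mult a b c d x y = (\<lambda>m. \<Sum>p<16. \<Sum>q<16.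
      (let (c1, r1) = qbasis a b (p div 4) (q div 4);
           (c2, r2) = qbasis c d (p mod 4) (q mod 4)
       in if 4 * r1 + r2 = m then c1 * c2 * x p * y q else 0))"

definition bq_lmat :: "'a::field \<Rightarrow> 'a \<Rightarrow> 'a \<Rightarrow> 'a \<Rightarrow> (nat \<Rightarrow> 'a) \<Rightarrow> 'a mat" where
  "bq_lmat a b c d x = mat 16 16 (\<lambda>(m,q). bq_mult a b c d x (\<lambda>p. if p = q then 1 else 0) m)"

text \<open>Reduced characteristic polynomial: the unique monic degree-4 polynomial whose
  4th power is the characteristic polynomial of left multiplication (D has degree 4);
  the reduced norm is (-1)^4 times its constant coefficient.\<close>
definition bq_Prd :: "'a::field \<Rightarrow> 'a \<Rightarrow> 'a \<Rightarrow> 'a \<Rightarrow> (nat \<Rightarrow> 'a) \<Rightarrow> 'a poly" where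
  "bq_Prd a b c d x = (THE p. lead_coeff p = 1 \<and> degree p = 4 \<and> p ^ 4 = char_poly (bq_lmat a b c d x))"

definition bq_Nrd :: "'a::field \<Rightarrow> 'a \<Rightarrow> 'a \<Rightarrow> 'a \<Rightarrow> (nat \<Rightarrow> 'a) \<Rightarrow> 'a" where
  "bq_Nrd a b c d x = coeff (bq_Prd a b c d x) 0"

text \<open>sigma = tensor product of the canonical involutions: e_s \<otimes> f_t \<mapsto> eps_s eps_t e_s \<otimes> f_t,
  with eps_0 = 1 and eps_1 = eps_2 = eps_3 = -1.\<close>
definition bq_sigma :: "(nat \<Rightarrow> 'a::field) \<Rightarrow> nat \<Rightarrow> 'a" where
  "bq_sigma x = (\<lambda>m. (if m div 4 = 0 then 1 else -1) * (if m mod 4 = 0 then 1 else -1) * x m)"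

definition bq_Sym :: "(nat \<Rightarrow> 'a::field) set" where
  "bq_Sym = {u \<in> bq_carrier. bq_sigma u = u}"

end

theory Submission
  imports Defs "HOL-Algebra.Algebraic_Closure_Type"
begin

text \<open>
  Let \<open>V = Q\<^sub>1\<^sup>0 \<oplus> Q\<^sub>2\<^sup>0\<close> be the space of skew elements of \<open>D\<close>, with the form \<open>x + y \<mapsto> x\<^sup>2 - y\<^sup>2\<close>; since \<open>-1\<close>
  is a square, this form is isometric to \<open>q\<close>. As \<open>q\<close> has square determinant, Witt cancellation shows that
  \<open>\<lambda>q\<close> is a sum of two Pfister forms iff \<open>V\<close> contains a three-dimensional subspace of
  determinant \<open>\<lambda>\<close>. Write \<open>(x + y)~ = x - y\<close>. If \<open>v\<^sub>1, v\<^sub>2, v\<^sub>3\<close> is an orthogonal basis of such a subspace,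
  then \<open>v\<^sub>1 v\<^sub>2~ v\<^sub>3\<close> is symmetric, and its reduced norm is \<open>(q(v\<^sub>1) q(v\<^sub>2) q(v\<^sub>3))\<^sup>2\<close>.
  Conversely, if \<open>u\<close> is symmetric with \<open>Nrd u = \<lambda>\<^sup>2\<close>, then \<open>v \<mapsto> u v~ u / \<lambda>\<close> is an involutive isometry
  of \<open>V\<close> (over a splitting field: the Hodge star of the quadratic form \<open>u\<close>), and
  the space of its fixed vectors has dimension three and determinant \<open>\<lambda>\<close>.
\<close>

section \<open>Diagonal forms and Witt cancellation\<close>

text \<open>A sum of two Pfister forms has dimension eight, and its two entries 1 span a hyperbolic
  plane because -1 is a square; cancelling it leaves \<open>[x, y, x * y, z, w, z * w]\<close>. Each
  half has square determinant, so inside q, where all values are divided by \<lambda>, its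
  determinant is \<lambda> up to squares. Conversely, the orthogonal complement of a subspace of
  determinant \<lambda> again has determinant \<lambda> up to squares, and both halves can be
  rescaled to the required shape. The obstacle is the reduced norm, which is given only as the
  constant term of a fourth root of a characteristic polynomial of degree 16. Splitting D takes
  square roots of a and c, but the formula found in the split algebra contains only a and c
  themselves, so it makes sense over k and can be verified in the algebraic closure. The other
  arguments about D become polynomial identities in coordinates.\<close>

lemma sum_lessThan_add:
  "(\<Sum>i<n + m. g i) = (\<Sum>i<n. g i) + (\<Sum>i<m::nat. g (n + i) :: 'a::comm_monoid_add)"
  by (induction m) (simp_all add: add.assoc)

definition bil :: "'a::field list \<Rightarrow> (nat \<Rightarrow> 'a) \<Rightarrow> (nat \<Rightarrow> 'a) \<Rightarrow> 'a" where
  "bil phi v w = (\<Sum>i<length phi. phi ! i * (v i * w i))"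

text \<open>The list \<open>psi\<close> may be shorter than \<open>phi\<close>, so that subforms,
  orthogonal families and full isometries are handled by one notion. If no entry of
  \<open>psi\<close> is 0, this is an isometric embedding of \<open>psi\<close>.\<close>

definition frame :: "'a::field list \<Rightarrow> 'a list \<Rightarrow> (nat \<Rightarrow> nat \<Rightarrow> 'a) \<Rightarrow> bool" where
  "frame phi psi f \<longleftrightarrow>
     (\<forall>i<length psi. \<forall>j<length psi. bil phi (f i) (f j) = (if i = j then psi ! i else 0))"

lemma frameI:
  assumes "\<And>i j. i < length psi \<Longrightarrow> j < length psi \<Longrightarrow> bil phi (f i) (f j) = (if i = j then psi ! i else 0)"
  shows "frame phi psi f"
  using assms by (simp add: frame_def)

lemma frameD:
  assumes "frame phi psi f" "i < length psi" "j < length psi"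
  shows "bil phi (f i) (f j) = (if i = j then psi ! i else 0)"
  using assms by (simp add: frame_def)

lemma bil_commute: "bil phi v w = bil phi w v"
  by (simp add: bil_def mult.commute)

lemma bil_add_left: "bil phi (\<lambda>r. v r + w r) z = bil phi v z + bil phi w z"
  by (simp add: bil_def algebra_simps sum.distrib)

lemma bil_add_right: "bil phi z (\<lambda>r. v r + w r) = bil phi z v + bil phi z w"
  by (simp add: bil_def algebra_simps sum.distrib)

lemma bil_scale_left: "bil phi (\<lambda>r. s * v r) w = s * bil phi v w"
  by (simp add: bil_def sum_distrib_left algebra_simps)

lemma bil_scale_right: "bil phi w (\<lambda>r. s * v r) = s * bil phi w v"
  by (simp add: bil_def sum_distrib_left algebra_simps)

lemma bil_sum_left: "bil phi (\<lambda>r. \<Sum>k\<in>S. g k r) z = (\<Sum>k\<in>S. bil phi (g k) z)"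
  by (induction S rule: infinite_finite_induct) (simp_all add: bil_add_left, simp_all add: bil_def)

lemma bil_sum_right: "bil phi z (\<lambda>r. \<Sum>k\<in>S. g k r) = (\<Sum>k\<in>S. bil phi z (g k))"
  by (subst (1 2) bil_commute) (rule bil_sum_left)

lemmas bil_linear = bil_add_left bil_add_right bil_scale_left bil_scale_right

lemma qf_val_bil: "qf_val phi v = bil phi v v"
  by (simp add: qf_val_def bil_def power2_eq_square)

lemma bil_snoc: "bil (phi @ [c]) v w = bil phi v w + c * (v (length phi) * w (length phi))"
  by (simp add: bil_def nth_append)

lemma bil_append:
  "bil (phi @ psi) v w = bil phi v w + bil psi (\<lambda>r. v (length phi + r)) (\<lambda>r. w (length phi + r))"
proof -
  have "bil (phi @ psi) v w = (\<Sum>i<length phi + length psi. (phi @ psi) ! i * (v i * w i))"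
    by (simp add: bil_def)
  also have "\<dots> = (\<Sum>i<length phi. (phi @ psi) ! i * (v i * w i)) +
      (\<Sum>i<length psi. (phi @ psi) ! (length phi + i) * (v (length phi + i) * w (length phi + i)))"
    by (rule sum_lessThan_add)
  also have "\<dots> = bil phi v w + bil psi (\<lambda>r. v (length phi + r)) (\<lambda>r. w (length phi + r))"
    by (simp add: bil_def nth_append)
  finally show ?thesis .
qed

lemma bil_scale_qf: "bil (scale_qf l phi) v w = l * bil phi v w"
  by (simp add: bil_def scale_qf_def sum_distrib_left algebra_simps)

lemma length_scale_qf [simp]: "length (scale_qf l phi) = length phi"
  by (simp add: scale_qf_def)

lemma gram_carrier [simp]: "gram phi \<in> carrier_mat (length phi) (length phi)"
  by (simp add: gram_def)

lemma congruent_gram_entry: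
  assumes T: "T \<in> carrier_mat (length phi) m" and i: "i < m" "j < m"
  shows "(transpose_mat T * gram phi * T) $$ (i, j) = bil phi (\<lambda>r. T $$ (r, i)) (\<lambda>r. T $$ (r, j))"
proof -
  have GT: "(gram phi * T) $$ (r, j) = phi ! r * T $$ (r, j)" if "r < length phi" for r
  proof -
    have "(gram phi * T) $$ (r, j) = (\<Sum>s<length phi. gram phi $$ (r, s) * T $$ (s, j))"
      using T i that
      by (simp add: scalar_prod_def gram_def atLeast0LessThan)
    also have "\<dots> = (\<Sum>s<length phi. if s = r then phi ! r * T $$ (r, j) else 0)"
      using that by (intro sum.cong) (auto simp: gram_def)
    finally show ?thesis using that by simp
  qed
  have "transpose_mat T * gram phi * T = transpose_mat T * (gram phi * T)"
    using T by (intro assoc_mult_mat) auto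
  then have "(transpose_mat T * gram phi * T) $$ (i, j)
      = (\<Sum>r<length phi. T $$ (r, i) * (gram phi * T) $$ (r, j))"
    using T i by (simp add: scalar_prod_def atLeast0LessThan gram_def)
  then show ?thesis by (simp add: GT bil_def algebra_simps)
qed

lemma det_gram: "det (gram phi) = prod_list phi"
proof -
  have "det (gram phi) = prod_list (diag_mat (gram phi))"
    by (rule det_upper_triangular[of _ "length phi"]) (auto simp: gram_def upper_triangular_def)
  also have "diag_mat (gram phi) = phi"
    by (rule nth_equalityI) (auto simp: diag_mat_def gram_def)
  finally show ?thesis .
qed

lemma invertible_matE:
  assumes A: "A \<in> carrier_mat n n" and inv: "invertible_mat A"
  obtains B where "B \<in> carrier_mat n n" "A * B = 1\<^sub>m n" "B * A = 1\<^sub>m n"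
proof -
  from inv obtain B where AB: "A * B = 1\<^sub>m n" and BA: "B * A = 1\<^sub>m (dim_row B)"
    using A by (auto simp: invertible_mat_def inverts_mat_def)
  have "dim_col B = n" using arg_cong[OF AB, of dim_col] by simp
  moreover have "dim_row B = n" using arg_cong[OF BA, of dim_col] A by simp
  ultimately show ?thesis using that[of B] AB BA by auto
qed

lemma invertible_mat_of_det:
  assumes A: "(A :: 'a::field mat) \<in> carrier_mat n n" and "det A \<noteq> 0"
  shows "invertible_mat A"
proof -
  obtain B where "B \<in> carrier_mat n n" "A * B = 1\<^sub>m n" "B * A = 1\<^sub>m n"
    using det_non_zero_imp_unit[OF assms, of undefined] by (auto simp: Units_def ring_mat_def)
  then show ?thesis using A by (auto simp: invertible_mat_def inverts_mat_def)
qed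

lemma frame_congruence:
  assumes f: "frame phi psi f" and len: "length phi = length psi"
  obtains T where "T \<in> carrier_mat (length phi) (length phi)"
    "transpose_mat T * gram phi * T = gram psi" "(det T)^2 * prod_list phi = prod_list psi"
proof -
  define n where "n = length phi"
  define T where "T = mat n n (\<lambda>(r, i). f i r)"
  have T: "T \<in> carrier_mat n n" by (simp add: T_def)
  have eq: "transpose_mat T * gram phi * T = gram psi"
  proof (rule eq_matI)
    fix i j assume "i < dim_row (gram psi)" "j < dim_col (gram psi)"
    then have ij: "i < n" "j < n" by (auto simp: gram_def n_def len)
    have "(transpose_mat T * gram phi * T) $$ (i, j) = bil phi (\<lambda>r. T $$ (r, i)) (\<lambda>r. T $$ (r, j))"
      using T ij by (intro congruent_gram_entry) (auto simp: n_def)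
    also have "\<dots> = bil phi (f i) (f j)"
      using ij by (simp add: bil_def T_def n_def)
    finally show "(transpose_mat T * gram phi * T) $$ (i, j) = gram psi $$ (i, j)"
      using frameD[OF f, of i j] ij by (simp add: gram_def n_def len)
  qed (use T in \<open>auto simp: gram_def n_def len\<close>)
  have G: "gram phi \<in> carrier_mat n n" by (simp add: n_def)
  have "det (transpose_mat T * gram phi * T) = det T * det (gram phi) * det T"
    using T G by (simp add: det_mult[of _ n] det_transpose[of _ n])
  then have "(det T)^2 * prod_list phi = prod_list psi"
    by (simp add: eq det_gram power2_eq_square algebra_simps)
  with that[of T] T eq show ?thesis by (simp add: n_def)
qed

text \<open>Comparing determinants of the Gram matrices shows that the transition matrix is
  invertible once \<open>psi\<close> has no zero entry.\<close>

lemma qf_isometric_frameI: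
  assumes f: "frame phi psi f" and len: "length phi = length psi" and nz: "0 \<notin> set psi"
  shows "qf_isometric phi psi"
proof -
  obtain T where T: "T \<in> carrier_mat (length phi) (length phi)"
    and eq: "transpose_mat T * gram phi * T = gram psi" and "(det T)^2 * prod_list phi = prod_list psi"
    by (rule frame_congruence[OF f len])
  then have "det T \<noteq> 0" using nz by (auto simp: prod_list_zero_iff)
  then have "invertible_mat T" using T by (simp add: invertible_mat_of_det)
  then show ?thesis using T eq len by (auto simp: qf_isometric_def)
qed

lemma qf_isometric_frameE:
  assumes "qf_isometric phi psi"
  obtains f where "frame phi psi f" "length phi = length psi"
proof -
  from assms obtain T where T: "T \<in> carrier_mat (length phi) (length phi)"
    and eq: "transpose_mat T * gram phi * T = gram psi" and len: "length phi = length psi"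
    by (auto simp: qf_isometric_def)
  have "frame phi psi (\<lambda>i r. T $$ (r, i))"
  proof (rule frameI)
    fix i j assume "i < length psi" "j < length psi"
    then show "bil phi (\<lambda>r. T $$ (r, i)) (\<lambda>r. T $$ (r, j)) = (if i = j then psi ! i else 0)"
      using congruent_gram_entry[OF T, of i j, symmetric] len unfolding eq by (simp add: gram_def)
  qed
  with len show ?thesis using that by blast
qed

lemma qf_isometric_sym:
  assumes "qf_isometric phi psi"
  shows "qf_isometric psi phi"
proof -
  define n where "n = length phi"
  from assms obtain T where T: "T \<in> carrier_mat n n" and inv: "invertible_mat T"
    and eq: "transpose_mat T * gram phi * T = gram psi" and len: "length phi = length psi"
    by (auto simp: qf_isometric_def n_def)
  from invertible_matE[OF T inv] obtain S
    where S: "S \<in> carrier_mat n n" and TS: "T * S = 1\<^sub>m n" and ST: "S * T = 1\<^sub>m n"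
    by blast
  have G: "gram phi \<in> carrier_mat n n" by (simp add: n_def)
  have StTt: "transpose_mat S * transpose_mat T = 1\<^sub>m n"
    using S T TS by (simp flip: transpose_mult)
  have "transpose_mat S * gram psi * S = transpose_mat S * (transpose_mat T * (gram phi * (T * S)))"
    using S T G unfolding eq[symmetric]
    by (simp add: assoc_mult_mat[of _ n n _ n _ n])
  also have "\<dots> = transpose_mat S * transpose_mat T * gram phi"
    using S T G by (simp add: TS assoc_mult_mat[of _ n n _ n _ n])
  also have "\<dots> = gram phi" using G by (simp add: StTt)
  finally have "transpose_mat S * gram psi * S = gram phi" .
  moreover have "invertible_mat S"
    using S T TS ST by (auto simp: invertible_mat_def inverts_mat_def)
  ultimately show ?thesis using S len by (auto simp: qf_isometric_def n_def)
qed

lemma bil_frame: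
  assumes "frame phi psi f"
  shows "bil phi (\<lambda>r. \<Sum>k<length psi. v k * f k r) (\<lambda>r. \<Sum>k<length psi. w k * f k r) = bil psi v w"
proof -
  have "bil phi (\<lambda>r. \<Sum>k<length psi. v k * f k r) (\<lambda>r. \<Sum>k<length psi. w k * f k r)
      = (\<Sum>k<length psi. \<Sum>l<length psi. v k * (w l * bil phi (f k) (f l)))"
    by (simp add: bil_sum_left bil_sum_right bil_scale_left bil_scale_right)
  also have "\<dots> = (\<Sum>k<length psi. \<Sum>l<length psi. if l = k then v k * (w k * psi ! k) else 0)"
    using frameD[OF assms] by (intro sum.cong refl) auto
  also have "\<dots> = bil psi v w"
    by (simp add: bil_def algebra_simps)
  finally show ?thesis .
qed

lemma frame_trans:
  assumes "frame phi psi f" and "frame psi chi g"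
  shows "frame phi chi (\<lambda>i r. \<Sum>k<length psi. g i k * f k r)"
  using bil_frame[OF assms(1)] frameD[OF assms(2)] by (intro frameI) simp

lemma frame_append:
  assumes f: "frame phi psi f" and g: "frame phi2 psi2 g" 
  shows "frame (phi @ phi2) (psi @ psi2)
    (\<lambda>i r. if i < length psi then (if r < length phi then f i r else 0)
           else (if r < length phi then 0 else g (i - length psi) (r - length phi)))" (is "frame _ _ ?h")
proof (rule frameI)
  fix i j assume ij: "i < length (psi @ psi2)" "j < length (psi @ psi2)"
  have "bil phi (?h i) (?h j) = (if i < length psi \<and> j < length psi then bil phi (f i) (f j) else 0)"
    unfolding bil_def by (auto intro!: sum.neutral)
  moreover have "bil phi2 (\<lambda>r. ?h i (length phi + r)) (\<lambda>r. ?h j (length phi + r))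
      = (if i < length psi \<or> j < length psi then 0
         else bil phi2 (g (i - length psi)) (g (j - length psi)))"
    by (simp add: bil_def)
  ultimately show "bil (phi @ phi2) (?h i) (?h j) = (if i = j then (psi @ psi2) ! i else 0)"
    using ij frameD[OF f, of i j] frameD[OF g, of "i - length psi" "j - length psi"]
    by (auto simp: bil_append nth_append)
qed

text \<open>Witt cancellation: with \<open>s\<close> the last coordinate of the vector to be removed, one of
  \<open>s + 1\<close>, \<open>s - 1\<close> is nonzero, and a multiple of that vector corrects the others.\<close>

lemma frame_cancel:
  assumes two: "(2::'a::field) \<noteq> 0" and f: "frame (phi @ [c]) (psi @ [c]) f"
    and len: "length phi = length (psi :: 'a list)"
  obtains g where "frame phi psi g"
proof -
  define n where "n = length phi"
  define s where "s = f n n"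
  \<comment> \<open>The correction by \<open>k\<close> preserves the Gram matrix iff
    \<open>k * k * (1 - s * s) - 2 * k * s - 1 = 0\<close>. The left side factors as
    \<open>(k * (1 - s) - 1) * (k * (1 + s) + 1)\<close>, and \<open>k\<close> is a root of a factor
    that can be solved.\<close>
  define k where "k = (if s = -1 then 1 / (1 - s) else - 1 / (1 + s))"
  have "k * k * (1 - s * s) - 2 * k * s = 1"
  proof (cases "s = -1")
    case True
    then show ?thesis using two by (simp add: k_def)
  next
    case False
    then have "1 + s \<noteq> 0" by (metis add.inverse_unique)
    then show ?thesis using False by (simp add: k_def divide_simps) (simp add: algebra_simps)
  qed
  note k = this
  have F: "bil phi (f i) (f j) + c * (f i n * f j n) = (if i = j then (psi @ [c]) ! i else 0)"
    if "i \<le> n" "j \<le> n" for i j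
    using frameD[OF f, of i j] that len by (simp add: bil_snoc n_def)
  define g where "g i = (\<lambda>r. f i r + (k * f i n) * f n r)" for i
  have "frame phi psi g"
  proof (rule frameI)
    fix i j assume ij: "i < length psi" "j < length psi"
    then have le: "i < n" "j < n" using len by (auto simp: n_def)
    have i: "bil phi (f i) (f n) = - c * s * f i n" and j: "bil phi (f n) (f j) = - c * s * f j n"
      using F[of i n] F[of n j] le by (simp_all add: s_def algebra_simps eq_neg_iff_add_eq_0)
    have nn: "bil phi (f n) (f n) = c * (1 - s * s)"
      using F[of n n] len by (simp add: s_def n_def nth_append algebra_simps eq_diff_eq)
    have ij': "bil phi (f i) (f j) = (if i = j then psi ! i else 0) - c * (f i n * f j n)"
      using F[of i j] le ij by (simp add: nth_append eq_diff_eq)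
    have "bil phi (g i) (g j) = bil phi (f i) (f j) + k * f j n * bil phi (f i) (f n)
        + k * f i n * bil phi (f n) (f j) + k * f i n * (k * f j n) * bil phi (f n) (f n)"
      by (simp add: g_def bil_linear algebra_simps)
    also have "\<dots> = (if i = j then psi ! i else 0) +
        c * (f i n * f j n) * (k * k * (1 - s * s) - 2 * k * s - 1)"
      unfolding i j nn ij' by (simp add: algebra_simps)
    finally show "bil phi (g i) (g j) = (if i = j then psi ! i else 0)" by (simp add: k)
  qed
  then show ?thesis using that by blast
qed

lemma length_hyp [simp]: "length (hyp m) = 2 * m"
  by (induction m) (auto simp: hyp_def)

lemma hyp_Suc: "hyp (Suc m) = hyp m @ [1, -1]"
  unfolding hyp_def by (simp only: replicate_append_same[symmetric] replicate_Suc concat_append) simp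

lemma frame_cancel_hyp:
  assumes two: "(2::'a::field) \<noteq> 0" and "frame (phi @ hyp m) (psi @ hyp m) f"
    and len: "length phi = length (psi :: 'a list)"
  obtains g where "frame phi psi g"
  using assms(2)
proof (induction m arbitrary: f thesis)
  case 0
  then show ?case by (simp add: hyp_def)
next
  case (Suc m)
  have "frame (((phi @ hyp m) @ [1]) @ [-1]) (((psi @ hyp m) @ [1]) @ [-1]) f"
    using Suc.prems(2) by (simp add: hyp_Suc)
  then obtain g where "frame ((phi @ hyp m) @ [1]) ((psi @ hyp m) @ [1]) g"
    by (rule frame_cancel[OF two]) (use len in auto)
  then obtain h where "frame (phi @ hyp m) (psi @ hyp m) h"
    by (rule frame_cancel[OF two]) (use len in auto)
  then show ?case using Suc.IH Suc.prems(1) by blast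
qed

section \<open>The splitting representation and the reduced norm\<close>

lemma sum_lessThan_mult:
  "(\<Sum>i<m * (n::nat). g i) = (\<Sum>i<m. \<Sum>j<n. g (n * i + j) :: 'a::comm_monoid_add)"
proof (induction m)
  case (Suc m)
  then show ?case using sum_lessThan_add[of g "m * n" n] by (simp add: ac_simps)
qed simp

lemma less_3_cases: "(i::nat) < 3 \<Longrightarrow> i = 0 \<or> i = 1 \<or> i = 2"
  by linarith

lemma less_4_cases: "(s::nat) < 4 \<Longrightarrow> s = 0 \<or> s = 1 \<or> s = 2 \<or> s = 3"
  by linarith

section \<open>Explicit determinants and products of small matrices\<close>

lemma det_mat_Suc:
  "det (mat (Suc n) (Suc n) f :: 'a::comm_ring_1 mat)
    = (\<Sum>j<Suc n. f (0, j) * ((-1) ^ j * det (mat n n (\<lambda>(r, k). f (Suc r, if k < j then k else Suc k)))))"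
proof -
  have "det (mat (Suc n) (Suc n) f) = (\<Sum>j<Suc n. mat (Suc n) (Suc n) f $$ (0, j) *
      cofactor (mat (Suc n) (Suc n) f) 0 j)"
    by (rule laplace_expansion_row[of _ "Suc n"]) auto
  also have "\<dots> = (\<Sum>j<Suc n. f (0, j) * ((-1) ^ j *
      det (mat n n (\<lambda>(r, k). f (Suc r, if k < j then k else Suc k)))))"
  proof (rule sum.cong)
    fix j assume "j \<in> {..<Suc n}"
    moreover have "mat_delete (mat (Suc n) (Suc n) f) 0 j = mat n n (\<lambda>(r, k). f (Suc r, if k < j then k else Suc k))"
      by (rule eq_matI) (auto simp: mat_delete_def)
    ultimately show "mat (Suc n) (Suc n) f $$ (0, j) * cofactor (mat (Suc n) (Suc n) f) 0 j
      = f (0, j) * ((-1) ^ j * det (mat n n (\<lambda>(r, k). f (Suc r, if k < j then k else Suc k))))"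
      by (simp add: cofactor_def)
  qed simp
  finally show ?thesis .
qed

lemma det_mat_2:
  "det (mat 2 2 f :: 'a::comm_ring_1 mat) = f (0,0) * f (1,1) - f (0,1) * f (1,0)"
  by (simp add: numeral_2_eq_2 det_mat_Suc)

text \<open>HOL-Algebra redefines the name of the proof method \<open>algebra\<close>, hence the qualified name below.\<close>

lemma det_mat_3:
  "det (mat 3 3 f :: 'a::idom mat) =
     f (0,0) * (f (1,1) * f (2,2) - f (1,2) * f (2,1))
   - f (0,1) * (f (1,0) * f (2,2) - f (1,2) * f (2,0))
   + f (0,2) * (f (1,0) * f (2,1) - f (1,1) * f (2,0))"
proof -
  have "det (mat (Suc 2) (Suc 2) f) =  f (0,0) * (f (1,1) * f (2,2) - f (1,2) * f (2,1))
   - f (0,1) * (f (1,0) * f (2,2) - f (1,2) * f (2,0))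
   + f (0,2) * (f (1,0) * f (2,1) - f (1,1) * f (2,0))"
    unfolding det_mat_Suc det_mat_2 by (simp add: lessThan_Suc numeral_2_eq_2) Groebner_Basis.algebra
  then show ?thesis by (simp add: numeral_3_eq_3 numeral_2_eq_2)
qed

lemma det_mat_4:
  "det (mat 4 4 f :: 'a::idom mat) =
     f (0,0) * (f (1,1) * (f (2,2) * f (3,3) - f (2,3) * f (3,2))
              - f (1,2) * (f (2,1) * f (3,3) - f (2,3) * f (3,1))
              + f (1,3) * (f (2,1) * f (3,2) - f (2,2) * f (3,1)))
   - f (0,1) * (f (1,0) * (f (2,2) * f (3,3) - f (2,3) * f (3,2))
              - f (1,2) * (f (2,0) * f (3,3) - f (2,3) * f (3,0))
              + f (1,3) * (f (2,0) * f (3,2) - f (2,2) * f (3,0)))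
   + f (0,2) * (f (1,0) * (f (2,1) * f (3,3) - f (2,3) * f (3,1))
              - f (1,1) * (f (2,0) * f (3,3) - f (2,3) * f (3,0))
              + f (1,3) * (f (2,0) * f (3,1) - f (2,1) * f (3,0)))
   - f (0,3) * (f (1,0) * (f (2,1) * f (3,2) - f (2,2) * f (3,1))
              - f (1,1) * (f (2,0) * f (3,2) - f (2,2) * f (3,0))
              + f (1,2) * (f (2,0) * f (3,1) - f (2,1) * f (3,0)))" (is "_ = ?R")
proof -
  have "det (mat (Suc 3) (Suc 3) f) = ?R"
    unfolding det_mat_Suc det_mat_3 by (simp add: lessThan_Suc numeral_2_eq_2 numeral_3_eq_3) Groebner_Basis.algebra
  then show ?thesis by simp
qed

lemma mat_4_eqI:
  assumes "A \<in> carrier_mat 4 4" "B \<in> carrier_mat 4 4"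
    and "\<forall>i\<in>{0,1,2,3}. \<forall>j\<in>{0,1,2,3}. A $$ (i, j) = B $$ (i, j)"
  shows "A = B"
proof (rule eq_matI)
  fix i j assume "i < dim_row B" "j < dim_col B"
  then show "A $$ (i, j) = B $$ (i, j)"
    using assms less_4_cases[of i] less_4_cases[of j] by (metis carrier_matD insertCI)
qed (use assms in auto)

lemma mult_mat_4:
  "mat 4 4 f * mat 4 4 g = mat 4 4 (\<lambda>(i, j). f (i, 0) * g (0, j) + f (i, 1) * g (1, j) + f (i, 2) * g (2, j)
     + f (i, 3) * (g (3, j) :: 'a::comm_ring_1))"
  by (rule eq_matI) (simp_all add: scalar_prod_def numeral_eq_Suc add.assoc)

lemma add_mat_4:
  "mat 4 4 f + mat 4 4 g = mat 4 4 (\<lambda>(i, j). f (i, j) + (g (i, j) :: 'a::comm_ring_1))"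
  by (rule eq_matI) simp_all

lemma mat_4_cong:
  assumes "\<forall>i\<in>{0,1,2,3}. \<forall>j\<in>{0,1,2,3}. f (i, j) = g (i, j)"
  shows "mat 4 4 f = mat 4 4 g"
  using assms by (intro mat_4_eqI) auto

lemma nth_list_4: "[p, q, r, s] ! 0 = p" "[p, q, r, s] ! 1 = q" "[p, q, r, s] ! 2 = r" "[p, q, r, s] ! 3 = s"
  by simp_all

text \<open>The splitting representation of the quaternion algebra with \<open>i\<close> mapped to the
  diagonal matrix with entries \<open>\<alpha>, -\<alpha>\<close>.\<close>

definition qrep :: "'a::comm_ring_1 \<Rightarrow> 'a \<Rightarrow> nat \<Rightarrow> nat \<Rightarrow> nat \<Rightarrow> 'a" where
  "qrep \<alpha> b s r k =
    (if s = 0 then (if r = k then 1 else 0)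
     else if s = 1 then (if r = k then (if r = 0 then \<alpha> else - \<alpha>) else 0)
     else if s = 2 then (if r = k then 0 else if r = 0 then b else 1)
     else (if r = k then 0 else if r = 0 then \<alpha> * b else - \<alpha>))"

lemma qbasis_less: "s < 4 \<Longrightarrow> t < 4 \<Longrightarrow> snd (qbasis a b s t) < 4"
  by (auto simp: qbasis_def)

lemma qrep_mult:
  assumes "s < 4" "t < 4" "r < 2" "k < 2"
  shows "fst (qbasis (\<alpha> * \<alpha>) b s t) * qrep \<alpha> b (snd (qbasis (\<alpha> * \<alpha>) b s t)) r k
    = (\<Sum>l<2. qrep \<alpha> b s r l * qrep \<alpha> b t l k)"
  using less_4_cases[OF assms(1)] less_4_cases[OF assms(2)] less_2_cases[OF assms(3)] less_2_cases[OF assms(4)]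
  by (elim disjE; simp add: qbasis_def qrep_def numeral_2_eq_2 algebra_simps)

definition brep :: "'a::comm_ring_1 \<Rightarrow> 'a \<Rightarrow> 'a \<Rightarrow> 'a \<Rightarrow> nat \<Rightarrow> nat \<Rightarrow> nat \<Rightarrow> 'a" where
  "brep \<alpha> b \<gamma> d p r k =
     qrep \<alpha> b (p div 4) (r div 2) (k div 2) * qrep \<gamma> d (p mod 4) (r mod 2) (k mod 2)"

definition bqrep :: "'a::comm_ring_1 \<Rightarrow> 'a \<Rightarrow> 'a \<Rightarrow> 'a \<Rightarrow> (nat \<Rightarrow> 'a) \<Rightarrow> 'a mat" where
  "bqrep \<alpha> b \<gamma> d x = mat 4 4 (\<lambda>(r, k). \<Sum>p<16. x p * brep \<alpha> b \<gamma> d p r k)"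

lemma bqrep_carrier [simp]: "bqrep \<alpha> b \<gamma> d x \<in> carrier_mat 4 4"
  by (simp add: bqrep_def)

lemma brep_mult:
  assumes "p < 16" "q < 16" "r < 4" "k < 4"
  shows "fst (qbasis (\<alpha> * \<alpha>) b (p div 4) (q div 4)) * fst (qbasis (\<gamma> * \<gamma>) d (p mod 4) (q mod 4)) *
      brep \<alpha> b \<gamma> d (4 * snd (qbasis (\<alpha> * \<alpha>) b (p div 4) (q div 4)) + snd (qbasis (\<gamma> * \<gamma>) d (p mod 4) (q mod 4))) r k
    = (\<Sum>l<4. brep \<alpha> b \<gamma> d p r l * brep \<alpha> b \<gamma> d q l k)"
proof -
  define s where "s = snd (qbasis (\<alpha> * \<alpha>) b (p div 4) (q div 4))"
  define t where "t = snd (qbasis (\<gamma> * \<gamma>) d (p mod 4) (q mod 4))"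
  have t: "t < 4" unfolding t_def by (rule qbasis_less) auto
  have lt: "p div 4 < 4" "q div 4 < 4" "r div 2 < 2" "k div 2 < 2" using assms by auto
  have "(\<Sum>l<2*2. brep \<alpha> b \<gamma> d p r l * brep \<alpha> b \<gamma> d q l k)
    = (\<Sum>i<2. qrep \<alpha> b (p div 4) (r div 2) i * qrep \<alpha> b (q div 4) i (k div 2)) *
      (\<Sum>j<2. qrep \<gamma> d (p mod 4) (r mod 2) j * qrep \<gamma> d (q mod 4) j (k mod 2))"
    unfolding sum_lessThan_mult sum_product by (intro sum.cong refl) (simp add: brep_def algebra_simps)
  also have "\<dots> = (fst (qbasis (\<alpha> * \<alpha>) b (p div 4) (q div 4)) * qrep \<alpha> b s (r div 2) (k div 2)) *
      (fst (qbasis (\<gamma> * \<gamma>) d (p mod 4) (q mod 4)) * qrep \<gamma> d t (r mod 2) (k mod 2))"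
    unfolding s_def t_def using lt by (subst (1 2) qrep_mult) auto
  finally show ?thesis unfolding s_def[symmetric] t_def[symmetric]
    using t by (simp add: brep_def algebra_simps)
qed

text \<open>For fixed \<open>r\<close> and \<open>k\<close>, these are the coordinates of the matrix
  unit at \<open>(r, k)\<close> in the basis of 2 by 2 matrices given by
  \<open>qrep\<close>.\<close>

definition qdual :: "'a::field \<Rightarrow> 'a \<Rightarrow> nat \<Rightarrow> nat \<Rightarrow> nat \<Rightarrow> 'a" where
  "qdual \<alpha> b s r k =
    (if s = 0 then (if r = k then 1 / 2 else 0)
     else if s = 1 then (if r = k then (if r = 0 then 1 / (2 * \<alpha>) else - 1 / (2 * \<alpha>)) else 0)
     else if s = 2 then (if r = k then 0 else if r = 0 then 1 / (2 * b) else 1 / 2)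
     else (if r = k then 0 else if r = 0 then 1 / (2 * (\<alpha> * b)) else - 1 / (2 * \<alpha>)))"

lemma qrep_qdual:
  assumes "(2::'a::field) \<noteq> 0" "\<alpha> \<noteq> 0" "b \<noteq> 0" and "r < 2" "k < 2" "r' < 2" "k' < 2"
  shows "(\<Sum>s<4. qrep \<alpha> b s r k * qdual \<alpha> b s r' (k' :: nat)) = (if r = r' \<and> k = k' then 1 else 0 :: 'a)"
proof -
  have half: "1 / 2 + 1 / 2 = (1 :: 'a)"
    using assms(1) by (simp add: field_simps)
  have "(\<Sum>s<4. qrep \<alpha> b s r k * qdual \<alpha> b s r' k')
    = qrep \<alpha> b 0 r k * qdual \<alpha> b 0 r' k' + qrep \<alpha> b 1 r k * qdual \<alpha> b 1 r' k'
    + qrep \<alpha> b 2 r k * qdual \<alpha> b 2 r' k' + qrep \<alpha> b 3 r k * qdual \<alpha> b 3 r' k'"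
    by (simp add: eval_nat_numeral)
  then show ?thesis
    using less_2_cases[OF assms(4)] less_2_cases[OF assms(5)] less_2_cases[OF assms(6)]
      less_2_cases[OF assms(7)] assms(1-3)
    by (elim disjE; simp add: qdual_def qrep_def half)
qed

section \<open>Block diagonal matrices\<close>

definition blocks :: "nat \<Rightarrow> 'a::comm_ring_1 mat \<Rightarrow> 'a mat" where
  "blocks n A = mat (4 * n) (4 * n) (\<lambda>(i, j). if i div 4 = j div 4 then A $$ (i mod 4, j mod 4) else 0)"

lemma det_blocks:
  assumes A: "(A :: 'a::idom mat) \<in> carrier_mat 4 4"
  shows "det (blocks n A) = det A ^ n"
proof (induction n)
  case 0
  then show ?case by (simp add: blocks_def)
next
  case (Suc n)
  have "blocks (Suc n) A = four_block_mat (blocks n A) (0\<^sub>m (4 * n) 4) (0\<^sub>m 4 (4 * n)) A"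
  proof (rule eq_matI)
    fix i j
    assume "i < dim_row (four_block_mat (blocks n A) (0\<^sub>m (4 * n) 4) (0\<^sub>m 4 (4 * n)) A)"
      and "j < dim_col (four_block_mat (blocks n A) (0\<^sub>m (4 * n) 4) (0\<^sub>m 4 (4 * n)) A)"
    then have ij: "i < 4 * Suc n" "j < 4 * Suc n" using A by (auto simp: blocks_def)
    have mod: "i mod 4 = i - 4 * n" "i div 4 = n" if "\<not> i < 4 * n" "i < 4 * Suc n" for i
    proof -
      show "i div 4 = n" using that by (intro div_nat_eqI) auto
      then show "i mod 4 = i - 4 * n" by (simp add: minus_mult_div_eq_mod[symmetric])
    qed
    have div: "i div 4 < n" if "i < 4 * n" for i
      using that by (intro less_mult_imp_div_less) (simp add: mult.commute)
    have dims: "dim_row A = 4" "dim_col A = 4" "dim_row (blocks n A) = 4 * n" "dim_col (blocks n A) = 4 * n"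
      using A by (auto simp: blocks_def)
    show "blocks (Suc n) A $$ (i, j) = four_block_mat (blocks n A) (0\<^sub>m (4 * n) 4) (0\<^sub>m 4 (4 * n)) A $$ (i, j)"
    proof (cases "i < 4 * n"; cases "j < 4 * n")
      assume "i < 4 * n" "j < 4 * n"
      then show ?thesis using ij by (simp add: dims) (simp add: blocks_def)
    next
      assume "i < 4 * n" "\<not> j < 4 * n"
      then show ?thesis using ij mod(2)[of j] div[of i] by (simp add: dims) (simp add: blocks_def)
    next
      assume "\<not> i < 4 * n" "j < 4 * n"
      then show ?thesis using ij mod(2)[of i] div[of j] by (simp add: dims) (simp add: blocks_def)
    next
      assume "\<not> i < 4 * n" "\<not> j < 4 * n"
      then show ?thesis using ij mod[of i] mod[of j] by (simp add: dims) (simp add: blocks_def)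
    qed
  qed (use A in \<open>auto simp: blocks_def\<close>)
  moreover have "blocks n A \<in> carrier_mat (4 * n) (4 * n)"
    by (simp add: blocks_def)
  ultimately have "det (blocks (Suc n) A) = det (blocks n A) * det A"
    using A by (simp add: det_four_block_mat_lower_left_zero[of _ "4 * n" _ 4])
  then show ?case using Suc by (simp add: mult.commute)
qed

lemma char_poly_blocks:
  assumes A: "(A :: 'a::idom mat) \<in> carrier_mat 4 4"
  shows "char_poly (blocks n A) = char_poly A ^ n"
proof -
  have "char_poly_matrix (blocks n A) = blocks n (char_poly_matrix A)"
  proof (rule eq_matI)
    fix i j assume "i < dim_row (blocks n (char_poly_matrix A))" "j < dim_col (blocks n (char_poly_matrix A))"
    then have ij: "i < 4 * n" "j < 4 * n" by (auto simp: blocks_def)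
    have "i = j" if "i div 4 = j div 4" "i mod 4 = j mod 4"
      using that by (metis div_mult_mod_eq)
    then show "char_poly_matrix (blocks n A) $$ (i, j) = blocks n (char_poly_matrix A) $$ (i, j)"
      using ij A by (auto simp: blocks_def char_poly_matrix_def)
  qed (auto simp: blocks_def char_poly_matrix_def)
  then show ?thesis
    using A by (simp add: char_poly_def det_blocks)
qed

text \<open>A symmetric element is \<open>t + \<Sum> M\<^bsub>ij\<^esub> e\<^sub>i f\<^sub>j\<close> with \<open>M\<close> a 3 by 3 matrix, \<open>M\<^bsub>ij\<^esub>\<close> being stored at index \<open>4i + j\<close>.
  Over a field in which \<open>M\<close> can be brought to a diagonal form with normalised entries \<open>m\<^sub>1, m\<^sub>2, m\<^sub>3\<close>, the commuting elements
  \<open>e\<^sub>i f\<^sub>i\<close> give the eigenvalues \<open>t + \<epsilon>\<^sub>1 m\<^sub>1 + \<epsilon>\<^sub>2 m\<^sub>2 + \<epsilon>\<^sub>3 m\<^sub>3\<close> with \<open>\<epsilon>\<^sub>1 \<epsilon>\<^sub>2 \<epsilon>\<^sub>3 = -1\<close>; their product, written in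
  terms of the invariants of \<open>M\<close>, is \<open>sym_nrd\<close>.\<close>

definition sym_cof :: "(nat \<Rightarrow> 'a::comm_ring_1) \<Rightarrow> nat \<Rightarrow> 'a" where
  "sym_cof u = (!) [0, 0, 0, 0,
     0, u 10 * u 15 - u 11 * u 14, u 11 * u 13 - u 9 * u 15, u 9 * u 14 - u 10 * u 13,
     0, u 14 * u 7 - u 15 * u 6, u 15 * u 5 - u 13 * u 7, u 13 * u 6 - u 14 * u 5,
     0, u 6 * u 11 - u 7 * u 10, u 7 * u 9 - u 5 * u 11, u 5 * u 10 - u 6 * u 9]"

definition sym_det :: "(nat \<Rightarrow> 'a::comm_ring_1) \<Rightarrow> 'a" where
  "sym_det u = u 5 * sym_cof u 5 + u 6 * sym_cof u 6 + u 7 * sym_cof u 7"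

definition sym_sq :: "'a::comm_ring_1 \<Rightarrow> 'a \<Rightarrow> 'a \<Rightarrow> 'a \<Rightarrow> (nat \<Rightarrow> 'a) \<Rightarrow> 'a" where
  "sym_sq a b c d u = a * c * (u 5)^2 + a * d * (u 6)^2 - a * c * d * (u 7)^2
     + b * c * (u 9)^2 + b * d * (u 10)^2 - b * c * d * (u 11)^2
     - a * b * c * (u 13)^2 - a * b * d * (u 14)^2 + a * b * c * d * (u 15)^2"

text \<open>In the normalised diagonal form this is the sum of the products m_i^2 m_j^2 with i < j,
  while \<open>sym_sq\<close> is the sum of the m_i^2. A squared cofactor is weighted by the squares
  of the basis elements belonging to its two rows and two columns.\<close>

definition sym_cof_sq :: "'a::comm_ring_1 \<Rightarrow> 'a \<Rightarrow> 'a \<Rightarrow> 'a \<Rightarrow> (nat \<Rightarrow> 'a) \<Rightarrow> 'a" where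
  "sym_cof_sq a b c d u = a * b * c * d *
    (b * d * (sym_cof u 5)^2 + b * c * (sym_cof u 6)^2 - b * (sym_cof u 7)^2
   + a * d * (sym_cof u 9)^2 + a * c * (sym_cof u 10)^2 - a * (sym_cof u 11)^2
   - d * (sym_cof u 13)^2 - c * (sym_cof u 14)^2 + (sym_cof u 15)^2)"

definition sym_nrd :: "'a::comm_ring_1 \<Rightarrow> 'a \<Rightarrow> 'a \<Rightarrow> 'a \<Rightarrow> (nat \<Rightarrow> 'a) \<Rightarrow> 'a" where
  "sym_nrd a b c d u = (u 0)^4 - 2 * (u 0)^2 * sym_sq a b c d u + 8 * a * b * c * d * u 0 * sym_det u
     + (sym_sq a b c d u)^2 - 4 * sym_cof_sq a b c d u"

lemma sym_cof_nth:
  "sym_cof u 5 = u 10 * u 15 - u 11 * u 14" "sym_cof u 6 = u 11 * u 13 - u 9 * u 15"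
  "sym_cof u 7 = u 9 * u 14 - u 10 * u 13" "sym_cof u 9 = u 14 * u 7 - u 15 * u 6"
  "sym_cof u 10 = u 15 * u 5 - u 13 * u 7" "sym_cof u 11 = u 13 * u 6 - u 14 * u 5"
  "sym_cof u 13 = u 6 * u 11 - u 7 * u 10" "sym_cof u 14 = u 7 * u 9 - u 5 * u 11"
  "sym_cof u 15 = u 5 * u 10 - u 6 * u 9"
  by (simp_all add: sym_cof_def)

lemmas sym_nrd_nth = sym_nrd_def sym_cof_sq_def sym_sq_def sym_det_def sym_cof_nth

definition symmetric_coords :: "(nat \<Rightarrow> 'a::zero) \<Rightarrow> bool" where
  "symmetric_coords u \<longleftrightarrow> u 1 = 0 \<and> u 2 = 0 \<and> u 3 = 0 \<and> u 4 = 0 \<and> u 8 = 0 \<and> u 12 = 0"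

lemma sum_16: "(\<Sum>p<16. g p) = g 0 + g 1 + g 2 + g 3 + g 4 + g 5 + g 6 + g 7 + g 8 + g 9 + g 10 + g 11
   + g 12 + g 13 + g 14 + (g (15::nat) :: 'a::comm_monoid_add)"
  by (simp add: eval_nat_numeral add.assoc)

lemma bqrep_sym:
  fixes \<alpha> b \<gamma> d :: "'a::comm_ring_1"
  assumes "symmetric_coords u"
  shows "bqrep \<alpha> b \<gamma> d u = mat 4 4 (\<lambda>(i, j).
    [[u 0 + \<alpha> * \<gamma> * u 5, \<alpha> * d * (u 6 + \<gamma> * u 7), b * \<gamma> * (u 9 + \<alpha> * u 13),
      b * d * (u 10 + \<gamma> * u 11 + \<alpha> * (u 14 + \<gamma> * u 15))],
     [\<alpha> * (u 6 - \<gamma> * u 7), u 0 - \<alpha> * \<gamma> * u 5, b * (u 10 - \<gamma> * u 11 + \<alpha> * (u 14 - \<gamma> * u 15)),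
      - b * \<gamma> * (u 9 + \<alpha> * u 13)],
     [\<gamma> * (u 9 - \<alpha> * u 13), d * (u 10 + \<gamma> * u 11 - \<alpha> * (u 14 + \<gamma> * u 15)), u 0 - \<alpha> * \<gamma> * u 5,
      - \<alpha> * d * (u 6 + \<gamma> * u 7)],
     [u 10 - \<gamma> * u 11 - \<alpha> * (u 14 - \<gamma> * u 15), - \<gamma> * (u 9 - \<alpha> * u 13),
      - \<alpha> * (u 6 - \<gamma> * u 7), u 0 + \<alpha> * \<gamma> * u 5]] ! i ! j)"
  using assms
  by (intro mat_4_eqI, simp, simp, unfold ball_simps bqrep_def symmetric_coords_def, intro conjI TrueI;
      simp add: sum_16 brep_def qrep_def algebra_simps)

text \<open>The chosen roots \<alpha> and \<gamma> survive in the determinant only through their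
  squares. This is what lets the formula descend to the base field.\<close>

lemma det_bqrep_sym:
  fixes \<alpha> b \<gamma> d :: "'a::idom"
  assumes "symmetric_coords u"
  shows "det (bqrep \<alpha> b \<gamma> d u) = sym_nrd (\<alpha> * \<alpha>) b (\<gamma> * \<gamma>) d u"
  unfolding bqrep_sym[OF assms] det_mat_4 prod.case nth_list_4 sym_nrd_nth by Groebner_Basis.algebra

lemma bq_mult_basis:
  assumes "q < 16"
  shows "bq_mult a b c d x (\<lambda>p. if p = q then 1 else 0) m = (\<Sum>p<16.
    if 4 * snd (qbasis a b (p div 4) (q div 4)) + snd (qbasis c d (p mod 4) (q mod 4)) = m
    then fst (qbasis a b (p div 4) (q div 4)) * fst (qbasis c d (p mod 4) (q mod 4)) * x p else 0)"
proof -
  have "(\<Sum>q'<16. if 4 * snd (qbasis a b (p div 4) (q' div 4)) + snd (qbasis c d (p mod 4) (q' mod 4)) = m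
        then fst (qbasis a b (p div 4) (q' div 4)) * fst (qbasis c d (p mod 4) (q' mod 4)) * x p *
          (if q' = q then 1 else 0) else 0) =
      (\<Sum>q'<16. if q' = q then
        (if 4 * snd (qbasis a b (p div 4) (q div 4)) + snd (qbasis c d (p mod 4) (q mod 4)) = m
        then fst (qbasis a b (p div 4) (q div 4)) * fst (qbasis c d (p mod 4) (q mod 4)) * x p else 0) else 0)" for p
    by (rule sum.cong) auto
  then show ?thesis
    using assms by (simp add: bq_mult_def Let_def split_beta)
qed

text \<open>The columns of this matrix are the images of the basis of \<open>D\<close> under the isomorphism from \<open>D\<close> onto the
  4 by 4 matrices (entry \<open>(r, k)\<close> stored at index \<open>4k + r\<close>); conjugation by it turns a left multiplication
  into four copies of one 4 by 4 block.\<close>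

definition split_mat :: "'a::comm_ring_1 \<Rightarrow> 'a \<Rightarrow> 'a \<Rightarrow> 'a \<Rightarrow> 'a mat" where
  "split_mat \<alpha> b \<gamma> d = mat 16 16 (\<lambda>(i, m). brep \<alpha> b \<gamma> d m (i mod 4) (i div 4))"

lemma split_mat_lmat:
  fixes \<alpha> b \<gamma> d :: "'a::field"
  shows "split_mat \<alpha> b \<gamma> d * bq_lmat (\<alpha> * \<alpha>) b (\<gamma> * \<gamma>) d x = blocks 4 (bqrep \<alpha> b \<gamma> d x) * split_mat \<alpha> b \<gamma> d"
proof (rule eq_matI)
  fix i q assume "i < dim_row (blocks 4 (bqrep \<alpha> b \<gamma> d x) * split_mat \<alpha> b \<gamma> d)"
    "q < dim_col (blocks 4 (bqrep \<alpha> b \<gamma> d x) * split_mat \<alpha> b \<gamma> d)"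
  then have iq: "i < 16" "q < 16" by (auto simp: blocks_def split_mat_def)
  define r where "r = i mod 4"
  define k where "k = i div 4"
  have rk: "r < 4" "k < 4" using iq by (auto simp: r_def k_def)
  let ?\<rho> = "brep \<alpha> b \<gamma> d"
  let ?t = "\<lambda>p. 4 * snd (qbasis (\<alpha> * \<alpha>) b (p div 4) (q div 4)) + snd (qbasis (\<gamma> * \<gamma>) d (p mod 4) (q mod 4))"
  let ?c = "\<lambda>p. fst (qbasis (\<alpha> * \<alpha>) b (p div 4) (q div 4)) * fst (qbasis (\<gamma> * \<gamma>) d (p mod 4) (q mod 4))"
  have t: "?t p < 16" if "p < 16" for p
  proof -
    have "p div 4 < 4" "q div 4 < 4" using that iq by auto
    then show ?thesis
      using qbasis_less[of "p div 4" "q div 4" "\<alpha> * \<alpha>" b]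
        qbasis_less[of "p mod 4" "q mod 4" "\<gamma> * \<gamma>" d] by simp
  qed
  have "(split_mat \<alpha> b \<gamma> d * bq_lmat (\<alpha> * \<alpha>) b (\<gamma> * \<gamma>) d x) $$ (i, q)
      = (\<Sum>m<16. ?\<rho> m r k * (\<Sum>p<16. if ?t p = m then ?c p * x p else 0))"
    using iq by (simp add: split_mat_def bq_lmat_def scalar_prod_def bq_mult_basis r_def k_def atLeast0LessThan)
  also have "\<dots> = (\<Sum>p<16. \<Sum>m<16. if m = ?t p then ?\<rho> (?t p) r k * (?c p * x p) else 0)"
    unfolding sum_distrib_left by (subst sum.swap) (intro sum.cong refl, auto)
  also have "\<dots> = (\<Sum>p<16. x p * (?c p * ?\<rho> (?t p) r k))"
    using t by (intro sum.cong refl) (simp add: algebra_simps)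
  also have "\<dots> = (\<Sum>p<16. x p * (\<Sum>l<4. ?\<rho> p r l * ?\<rho> q l k))"
    using iq rk by (intro sum.cong refl arg_cong2[of _ _ _ _ "(*)"] brep_mult) auto
  also have "\<dots> = (\<Sum>l<4. bqrep \<alpha> b \<gamma> d x $$ (r, l) * ?\<rho> q l k)"
    unfolding sum_distrib_left using rk
    by (subst sum.swap) (simp add: bqrep_def sum_distrib_right mult.assoc)
  also have "\<dots> = (\<Sum>k'<4. \<Sum>l<4. if k = k' then bqrep \<alpha> b \<gamma> d x $$ (r, l) * ?\<rho> q l k' else 0)"
    using rk by (subst sum.swap) simp
  also have "\<dots> = (\<Sum>j<4 * 4. (if i div 4 = j div 4 then bqrep \<alpha> b \<gamma> d x $$ (i mod 4, j mod 4) else 0) *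
      ?\<rho> q (j mod 4) (j div 4))"
    unfolding sum_lessThan_mult by (intro sum.cong refl) (auto simp: r_def k_def)
  also have "\<dots> = (blocks 4 (bqrep \<alpha> b \<gamma> d x) * split_mat \<alpha> b \<gamma> d) $$ (i, q)"
    using iq by (simp add: split_mat_def blocks_def scalar_prod_def atLeast0LessThan)
  finally show "(split_mat \<alpha> b \<gamma> d * bq_lmat (\<alpha> * \<alpha>) b (\<gamma> * \<gamma>) d x) $$ (i, q)
      = (blocks 4 (bqrep \<alpha> b \<gamma> d x) * split_mat \<alpha> b \<gamma> d) $$ (i, q)" .
qed (auto simp: blocks_def split_mat_def bq_lmat_def)

lemma split_mat_right_inverse:
  fixes \<alpha> b \<gamma> d :: "'a::field"
  assumes "(2::'a) \<noteq> 0" "\<alpha> \<noteq> 0" "b \<noteq> 0" "\<gamma> \<noteq> 0" "d \<noteq> 0"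
  obtains P where "P \<in> carrier_mat 16 16" "split_mat \<alpha> b \<gamma> d * P = 1\<^sub>m 16"
proof -
  \<comment> \<open>Column \<open>j\<close> holds the coordinates of the matrix unit with row
    \<open>j mod 4\<close> and column \<open>j div 4\<close>, which is the Kronecker product of two
    2 by 2 matrix units.\<close>
  define P where "P = mat 16 16 (\<lambda>(m, j). qdual \<alpha> b (m div 4) (j mod 4 div 2) (j div 4 div 2) *
    qdual \<gamma> d (m mod 4) (j mod 4 mod 2) (j div 4 mod 2))"
  have "split_mat \<alpha> b \<gamma> d * P = 1\<^sub>m 16"
  proof (rule eq_matI)
    fix i j assume "i < dim_row (1\<^sub>m 16 :: 'a mat)" "j < dim_col (1\<^sub>m 16 :: 'a mat)"
    then have ij: "i < 16" "j < 16" by auto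
    have ineq: "i mod 4 div 2 < 2" "i div 4 div 2 < 2" "j mod 4 div 2 < 2" "j div 4 div 2 < 2"
      using ij by auto
    have "(split_mat \<alpha> b \<gamma> d * P) $$ (i, j) = (\<Sum>m<4 * 4.
        qrep \<alpha> b (m div 4) (i mod 4 div 2) (i div 4 div 2) * qrep \<gamma> d (m mod 4) (i mod 4 mod 2) (i div 4 mod 2) *
        (qdual \<alpha> b (m div 4) (j mod 4 div 2) (j div 4 div 2) * qdual \<gamma> d (m mod 4) (j mod 4 mod 2) (j div 4 mod 2)))"
      using ij by (simp add: split_mat_def P_def scalar_prod_def atLeast0LessThan brep_def)
    also have "\<dots> = (\<Sum>s<4. qrep \<alpha> b s (i mod 4 div 2) (i div 4 div 2) * qdual \<alpha> b s (j mod 4 div 2) (j div 4 div 2)) *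
        (\<Sum>s<4. qrep \<gamma> d s (i mod 4 mod 2) (i div 4 mod 2) * qdual \<gamma> d s (j mod 4 mod 2) (j div 4 mod 2))"
      unfolding sum_lessThan_mult sum_product by (intro sum.cong refl) (simp add: algebra_simps)
    also have "\<dots> = (if i mod 4 div 2 = j mod 4 div 2 \<and> i div 4 div 2 = j div 4 div 2 then 1 else 0) *
        (if i mod 4 mod 2 = j mod 4 mod 2 \<and> i div 4 mod 2 = j div 4 mod 2 then 1 else 0)"
      using assms ineq by (subst (1 2) qrep_qdual) auto
    also have "\<dots> = (if i = j then 1 else 0)"
    proof -
      have "i = j" if "i mod 4 div 2 = j mod 4 div 2" "i mod 4 mod 2 = j mod 4 mod 2"
        "i div 4 div 2 = j div 4 div 2" "i div 4 mod 2 = j div 4 mod 2"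
        using that by (metis div_mult_mod_eq)
      then show ?thesis by auto
    qed
    finally show "(split_mat \<alpha> b \<gamma> d * P) $$ (i, j) = 1\<^sub>m 16 $$ (i, j)"
      using ij by simp
  qed (auto simp: split_mat_def P_def)
  then show ?thesis using that[of P] by (simp add: P_def)
qed

lemma char_poly_bq_lmat:
  fixes \<alpha> b \<gamma> d :: "'a::field"
  assumes "(2::'a) \<noteq> 0" "\<alpha> \<noteq> 0" "b \<noteq> 0" "\<gamma> \<noteq> 0" "d \<noteq> 0"
  shows "char_poly (bq_lmat (\<alpha> * \<alpha>) b (\<gamma> * \<gamma>) d x) = char_poly (bqrep \<alpha> b \<gamma> d x) ^ 4"
proof -
  let ?L = "bq_lmat (\<alpha> * \<alpha>) b (\<gamma> * \<gamma>) d x" and ?B = "blocks 4 (bqrep \<alpha> b \<gamma> d x)" and ?S = "split_mat \<alpha> b \<gamma> d"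
  obtain P where P: "P \<in> carrier_mat 16 16" and SP: "?S * P = 1\<^sub>m 16"
    using split_mat_right_inverse[OF assms] .
  have S: "?S \<in> carrier_mat 16 16" and L: "?L \<in> carrier_mat 16 16" and B: "?B \<in> carrier_mat 16 16"
    by (auto simp: split_mat_def bq_lmat_def blocks_def)
  have PS: "P * ?S = 1\<^sub>m 16"
    by (rule mat_mult_left_right_inverse[OF S P SP])
  have "P * ?B * ?S = P * (?S * ?L)"
    using P B S L by (simp add: split_mat_lmat assoc_mult_mat[of _ 16 16 _ 16 _ 16])
  also have "\<dots> = ?L"
    using P S L by (simp add: PS flip: assoc_mult_mat[of _ 16 16 _ 16 _ 16])
  finally have "similar_mat ?L ?B"
    using P S L B SP PS by (intro similar_matI[of _ _ _ _ 16]) auto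
  then show ?thesis by (simp add: char_poly_similar char_poly_blocks)
qed

text \<open>The matrix X - \<rho>(u) is itself the image of a symmetric element over the polynomial
  ring, with scalar coordinate X - u_0 and the other coordinates negated. The determinant formula,
  available over every integral domain, applies to it directly.\<close>

lemma char_poly_bqrep_sym:
  fixes \<alpha> b \<gamma> d :: "'a::idom"
  assumes "symmetric_coords u"
  shows "char_poly (bqrep \<alpha> b \<gamma> d u)
    = sym_nrd [:\<alpha> * \<alpha>:] [:b:] [:\<gamma> * \<gamma>:] [:d:] (\<lambda>p. if p = 0 then [:- u 0, 1:] else [:- u p:])"
proof -
  let ?v = "\<lambda>p. if p = 0 then [:- u 0, 1:] else [:- u p:]"
  have qrep: "qrep [:\<alpha>:] [:b:] s r k = [:qrep \<alpha> b s r k:]" for \<alpha> b :: 'a and s r k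
    by (auto simp: qrep_def one_pCons)
  have brep: "brep [:\<alpha>:] [:b:] [:\<gamma>:] [:d:] p r k = [:brep \<alpha> b \<gamma> d p r k:]" for p r k
    by (simp add: brep_def qrep)
  have coeff: "[:- (\<Sum>p\<in>P. g p):] = (\<Sum>p\<in>P. [:- g p:])" for P :: "nat set" and g :: "nat \<Rightarrow> 'a"
  proof (induction P rule: infinite_finite_induct)
    case (insert p P)
    then show ?case by (simp add: insert(3)[symmetric])
  qed auto
  have "char_poly_matrix (bqrep \<alpha> b \<gamma> d u) = bqrep [:\<alpha>:] [:b:] [:\<gamma>:] [:d:] ?v"
  proof (rule eq_matI)
    fix r k assume "r < dim_row (bqrep [:\<alpha>:] [:b:] [:\<gamma>:] [:d:] ?v)" "k < dim_col (bqrep [:\<alpha>:] [:b:] [:\<gamma>:] [:d:] ?v)"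
    then have rk: "r < 4" "k < 4" by (auto simp: bqrep_def)
    have "r = k" if "r div 2 = k div 2" "r mod 2 = k mod 2" using that by (metis div_mult_mod_eq)
    then have "brep \<alpha> b \<gamma> d 0 r k = (if r = k then 1 else 0)" by (auto simp: brep_def qrep_def)
    moreover have "bqrep [:\<alpha>:] [:b:] [:\<gamma>:] [:d:] ?v $$ (r, k) =
        (\<Sum>p<16. (if p = 0 then [:0, brep \<alpha> b \<gamma> d 0 r k:] else 0) + [:- (u p * brep \<alpha> b \<gamma> d p r k):])"
      using rk by (simp add: bqrep_def brep) (intro sum.cong, auto)
    ultimately show "char_poly_matrix (bqrep \<alpha> b \<gamma> d u) $$ (r, k) = bqrep [:\<alpha>:] [:b:] [:\<gamma>:] [:d:] ?v $$ (r, k)"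
      using rk by (simp add: char_poly_matrix_def bqrep_def sum.distrib coeff)
  qed (auto simp: bqrep_def char_poly_matrix_def)
  moreover have "symmetric_coords ?v" using assms by (simp add: symmetric_coords_def)
  ultimately show ?thesis by (simp add: char_poly_def det_bqrep_sym)
qed

section \<open>Descent from the algebraic closure\<close>

interpretation to_ac: inj_comm_ring_hom to_ac
  by unfold_locales auto

interpretation map_poly_to_ac: map_poly_inj_comm_ring_hom to_ac ..

lemma qbasis_to_ac: "qbasis (to_ac a) (to_ac b) s t = map_prod to_ac id (qbasis a b s t)"
  by (simp add: qbasis_def)

lemma map_mat_bq_lmat:
  "map_mat to_ac (bq_lmat a b c d x) = bq_lmat (to_ac a) (to_ac b) (to_ac c) (to_ac d) (\<lambda>p. to_ac (x p))"
proof (rule eq_matI)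
  fix m q assume "m < dim_row (bq_lmat (to_ac a) (to_ac b) (to_ac c) (to_ac d) (\<lambda>p. to_ac (x p)))"
    "q < dim_col (bq_lmat (to_ac a) (to_ac b) (to_ac c) (to_ac d) (\<lambda>p. to_ac (x p)))"
  then have "m < 16" "q < 16" by (auto simp: bq_lmat_def)
  then show "map_mat to_ac (bq_lmat a b c d x) $$ (m, q) =
      bq_lmat (to_ac a) (to_ac b) (to_ac c) (to_ac d) (\<lambda>p. to_ac (x p)) $$ (m, q)"
    by (simp add: bq_lmat_def bq_mult_basis qbasis_to_ac to_ac_sum if_distrib[of to_ac] cong: if_cong)
qed (auto simp: bq_lmat_def)

lemma (in comm_ring_hom) sym_nrd_hom:
  "hom (sym_nrd a b c d u) = sym_nrd (hom a) (hom b) (hom c) (hom d) (\<lambda>p. hom (u p))"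
proof -
  have numeral: "hom (numeral k) = numeral k" for k
    by (metis hom_of_nat of_nat_numeral)
  show ?thesis by (simp add: sym_nrd_nth hom_distribs numeral)
qed

lemma sym_nrd_scale: "sym_nrd a b c d (\<lambda>p. s * u p) = s ^ 4 * sym_nrd a b c d (u :: nat \<Rightarrow> 'a::idom)"
  by (simp add: sym_nrd_nth) Groebner_Basis.algebra

text \<open>This makes the definite description in \<open>bq_Prd\<close> well defined. In the
  factorisation (p - q)(p + q)(p^2 + q^2) of p^4 - q^4, the last two factors are sums of two monic
  polynomials, and such a sum is nonzero when 2 is.\<close>

lemma monic_power4_unique:
  fixes p q :: "'a::idom poly"
  assumes two: "(2::'a) \<noteq> 0" and p: "Polynomial.lead_coeff p = 1" and q: "Polynomial.lead_coeff q = 1" and eq: "p ^ 4 = q ^ 4"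
  shows "p = q"
proof -
  have "(p - q) * ((p + q) * (p^2 + q^2)) = 0" using eq by Groebner_Basis.algebra
  moreover have "Polynomial.lead_coeff r = Polynomial.lead_coeff (-s) \<Longrightarrow> Polynomial.lead_coeff r = 1 \<Longrightarrow> Polynomial.lead_coeff s \<noteq> 1" for r s :: "'a poly"
    using two by (metis lead_coeff_minus one_add_one neg_eq_iff_add_eq_0)
  then have no: "r + s \<noteq> 0" if "Polynomial.lead_coeff r = 1" "Polynomial.lead_coeff s = 1" for r s :: "'a poly"
    using that by (metis add_eq_0_iff2)
  have "p + q \<noteq> 0" using no[OF p q] .
  moreover have "p^2 + q^2 \<noteq> 0" by (rule no) (simp_all add: lead_coeff_power p q)
  ultimately show ?thesis by simp
qed

lemma bq_Sym_symmetric_coords: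
  assumes two: "(2::'a::field) \<noteq> 0" and u: "(u :: nat \<Rightarrow> 'a) \<in> bq_Sym"
  shows "symmetric_coords u"
proof -
  have zero: "x = 0" if "- x = (x::'a)" for x
    using that two by (metis add.right_inverse mult_2 mult_eq_0_iff)
  have \<sigma>: "bq_sigma u m = u m" for m using u by (simp add: bq_Sym_def)
  show ?thesis
    unfolding symmetric_coords_def
    using \<sigma>[of 1] \<sigma>[of 2] \<sigma>[of 3] \<sigma>[of 4] \<sigma>[of 8] \<sigma>[of 12]
    by (simp add: bq_sigma_def zero)
qed

lemma bq_SymI:
  assumes "symmetric_coords u" "\<And>m. m \<ge> 16 \<Longrightarrow> u m = 0"
  shows "(u :: nat \<Rightarrow> 'a::field) \<in> bq_Sym"
proof -
  have "bq_sigma u m = u m" for m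
  proof (cases "m < 16")
    case True
    then have "m = 0 \<or> m = 1 \<or> m = 2 \<or> m = 3 \<or> m = 4 \<or> m = 5 \<or> m = 6 \<or> m = 7 \<or> m = 8 \<or> m = 9
      \<or> m = 10 \<or> m = 11 \<or> m = 12 \<or> m = 13 \<or> m = 14 \<or> m = 15"
      by (simp add: numeral_eq_Suc less_Suc_eq)
    then show ?thesis using assms(1) by (auto simp: symmetric_coords_def bq_sigma_def)
  qed (use assms(2) in \<open>simp add: bq_sigma_def\<close>)
  then show ?thesis using assms(2) by (auto simp: bq_Sym_def bq_carrier_def)
qed

text \<open>The polynomial \<open>p\<close> is written down over the base field. Over the closure it
  becomes the characteristic polynomial of the 4 by 4 matrix of u, so its fourth power is that of
  left multiplication; injectivity of the embedding brings this equation back. The constant term is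
  the formula at -u, which equals the formula at u by homogeneity of degree 4.\<close>

lemma bq_Nrd_sym:
  fixes a b c d :: "'a::field"
  assumes two: "(2::'a) \<noteq> 0" and nz: "a \<noteq> 0" "b \<noteq> 0" "c \<noteq> 0" "d \<noteq> 0" and u: "u \<in> bq_Sym"
  shows "bq_Nrd a b c d u = sym_nrd a b c d u"
proof -
  define p where "p = sym_nrd [:a:] [:b:] [:c:] [:d:] (\<lambda>p. if p = 0 then [:- u 0, 1:] else [:- u p:])"
  have u: "symmetric_coords u" using u two by (rule bq_Sym_symmetric_coords[rotated])
  obtain \<alpha> \<gamma> where \<alpha>: "to_ac a = \<alpha> * \<alpha>" and \<gamma>: "to_ac c = \<gamma> * \<gamma>"
    using nth_root_exists[of 2 "to_ac a"] nth_root_exists[of 2 "to_ac c"]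
    unfolding power2_eq_square by (metis pos2)
  have two': "(2::'a alg_closure) \<noteq> 0" using two by (metis to_ac_eq_0_iff to_ac_numeral)
  have \<alpha>0: "\<alpha> \<noteq> 0" "\<gamma> \<noteq> 0" using \<alpha> \<gamma> nz by auto
  let ?u = "\<lambda>p. to_ac (u p)" and ?b = "to_ac b" and ?d = "to_ac d"
  have u': "symmetric_coords ?u" using u by (simp add: symmetric_coords_def)
  have L: "bq_lmat a b c d u \<in> carrier_mat 16 16" by (simp add: bq_lmat_def)
  have P: "map_poly to_ac p = char_poly (bqrep \<alpha> ?b \<gamma> ?d ?u)"
  proof -
    have "(\<lambda>p. map_poly to_ac (if p = 0 then [:- u 0, 1:] else [:- u p:]))
        = (\<lambda>p. if p = 0 then [:- ?u 0, 1:] else [:- ?u p:])"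
      by (auto simp: to_ac.map_poly_pCons_hom)
    then show ?thesis
      unfolding p_def map_poly_to_ac.sym_nrd_hom char_poly_bqrep_sym[OF u']
      by (simp add: to_ac.map_poly_pCons_hom flip: \<alpha> \<gamma>)
  qed
  have "map_poly to_ac (p ^ 4) = char_poly (bqrep \<alpha> ?b \<gamma> ?d ?u) ^ 4"
    by (simp add: P[symmetric] map_poly_to_ac.hom_power)
  also have "\<dots> = char_poly (bq_lmat (\<alpha> * \<alpha>) ?b (\<gamma> * \<gamma>) ?d ?u)"
    using two' \<alpha>0 nz by (subst char_poly_bq_lmat) auto
  also have "\<dots> = map_poly to_ac (char_poly (bq_lmat a b c d u))"
    unfolding \<alpha>[symmetric] \<gamma>[symmetric] map_mat_bq_lmat[symmetric] by (rule to_ac.char_poly_hom[OF L])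
  finally have p4: "p ^ 4 = char_poly (bq_lmat a b c d u)"
    by (rule map_poly_to_ac.injectivity)
  have "Polynomial.degree (map_poly to_ac p) = 4" "Polynomial.coeff (map_poly to_ac p) 4 = 1"
    unfolding P using degree_monic_char_poly[OF bqrep_carrier, of \<alpha> ?b \<gamma> ?d ?u] by auto
  then have deg: "Polynomial.degree p = 4" and lead: "Polynomial.lead_coeff p = 1" by auto
  have "bq_Prd a b c d u = p"
    unfolding bq_Prd_def
  proof (rule the_equality)
    fix q assume "Polynomial.lead_coeff q = 1 \<and> Polynomial.degree q = 4 \<and> q ^ 4 = char_poly (bq_lmat a b c d u)"
    then show "q = p" using monic_power4_unique[OF two _ lead] p4 by auto
  qed (use deg lead p4 in auto)
  then have "bq_Nrd a b c d u = poly p 0" by (simp add: bq_Nrd_def poly_0_coeff_0)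
  also have "\<dots> = sym_nrd a b c d (\<lambda>p. (-1) * u p)"
  proof -
    have ev: "comm_ring_hom (\<lambda>p :: 'a poly. poly p 0)" by unfold_locales auto
    have "(\<lambda>p. poly (if p = 0 then [:- u 0, 1:] else [:- u p:]) 0) = (\<lambda>p. (-1) * u p)" by auto
    then show ?thesis unfolding p_def comm_ring_hom.sym_nrd_hom[OF ev] by simp
  qed
  also have "\<dots> = sym_nrd a b c d u" unfolding sym_nrd_scale by simp
  finally show ?thesis .
qed

section \<open>From symmetric elements to three-dimensional subforms\<close>

text \<open>The Albert form of D: the values of x^2 - y^2 on the standard basis of V. With these
  signs rather than those of q, the identities below hold without a square root of -1.\<close>

definition albert :: "'a::field \<Rightarrow> 'a \<Rightarrow> 'a \<Rightarrow> 'a \<Rightarrow> 'a list" where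
  "albert a b c d = [a, b, - (a * b), - c, - d, c * d]"

lemma length_albert [simp]: "length (albert a b c d) = 6"
  by (simp add: albert_def)

lemma bil_albert: "bil (albert a b c d) v w = a * (v 0 * w 0) + b * (v 1 * w 1) - a * b * (v 2 * w 2)
   - c * (v 3 * w 3) - d * (v 4 * w 4) + c * d * (v 5 * w 5)"
  by (simp add: bil_def albert_def eval_nat_numeral)

definition gram_det3 :: "'a::field list \<Rightarrow> (nat \<Rightarrow> nat \<Rightarrow> 'a) \<Rightarrow> 'a" where
  "gram_det3 phi w = det (mat 3 3 (\<lambda>(i, j). bil phi (w i) (w j)))"

text \<open>\<open>hodge a b c d l u i\<close> are the coordinates in \<open>V\<close> of \<open>l e + u e~ u\<close> for the \<open>i\<close>-th basis vector \<open>e\<close>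
  of \<open>Q\<^sub>1\<^sup>0\<close>, that is, of \<open>l\<close> times the sum of \<open>e\<close> and its image under the involutive isometry.\<close>

definition hodge :: "'a::field \<Rightarrow> 'a \<Rightarrow> 'a \<Rightarrow> 'a \<Rightarrow> 'a \<Rightarrow> (nat \<Rightarrow> 'a) \<Rightarrow> nat \<Rightarrow> nat \<Rightarrow> 'a" where
  "hodge a b c d l u i j =
    (let p = l + (u 0)^2 - sym_sq a b c d u;
         S = (\<lambda>m n. c * u m * u n + d * u (m + 1) * u (n + 1) - c * d * u (m + 2) * u (n + 2));
         k = sym_cof u; t = u 0
     in [[p + 2*a * S 5 5, 2*a * S 5 9, 2*a * S 5 13,
          2*a*(t * u 5 - b*d * k 5), 2*a*(t * u 6 - b*c * k 6), 2*a*(t * u 7 + b * k 7)],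
         [2*b * S 9 5, p + 2*b * S 9 9, 2*b * S 9 13,
          2*b*(t * u 9 - a*d * k 9), 2*b*(t * u 10 - a*c * k 10), 2*b*(t * u 11 + a * k 11)],
         [- 2*a*b * S 13 5, - 2*a*b * S 13 9, p - 2*a*b * S 13 13,
          - 2*a*b*(t * u 13 + d * k 13), - 2*a*b*(t * u 14 + c * k 14), - 2*a*b*(t * u 15 - k 15)]] ! i ! j)"

lemma hodge_nth:
  fixes u :: "nat \<Rightarrow> 'a::field" and a b c d l :: 'a
  defines "p \<equiv> l + (u 0)^2 - sym_sq a b c d u"
  shows "hodge a b c d l u 0 0 = p + 2*a * (c * u 5 * u 5 + d * u 6 * u 6 - c * d * u 7 * u 7)"
    "hodge a b c d l u 0 1 = 2*a * (c * u 5 * u 9 + d * u 6 * u 10 - c * d * u 7 * u 11)"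
    "hodge a b c d l u 0 2 = 2*a * (c * u 5 * u 13 + d * u 6 * u 14 - c * d * u 7 * u 15)"
    "hodge a b c d l u 0 3 = 2*a * (u 0 * u 5 - b*d * sym_cof u 5)"
    "hodge a b c d l u 0 4 = 2*a * (u 0 * u 6 - b*c * sym_cof u 6)"
    "hodge a b c d l u 0 5 = 2*a * (u 0 * u 7 + b * sym_cof u 7)"
    "hodge a b c d l u 1 0 = 2*b * (c * u 9 * u 5 + d * u 10 * u 6 - c * d * u 11 * u 7)"
    "hodge a b c d l u 1 1 = p + 2*b * (c * u 9 * u 9 + d * u 10 * u 10 - c * d * u 11 * u 11)"
    "hodge a b c d l u 1 2 = 2*b * (c * u 9 * u 13 + d * u 10 * u 14 - c * d * u 11 * u 15)"
    "hodge a b c d l u 1 3 = 2*b * (u 0 * u 9 - a*d * sym_cof u 9)"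
    "hodge a b c d l u 1 4 = 2*b * (u 0 * u 10 - a*c * sym_cof u 10)"
    "hodge a b c d l u 1 5 = 2*b * (u 0 * u 11 + a * sym_cof u 11)"
    "hodge a b c d l u 2 0 = - 2*a*b * (c * u 13 * u 5 + d * u 14 * u 6 - c * d * u 15 * u 7)"
    "hodge a b c d l u 2 1 = - 2*a*b * (c * u 13 * u 9 + d * u 14 * u 10 - c * d * u 15 * u 11)"
    "hodge a b c d l u 2 2 = p - 2*a*b * (c * u 13 * u 13 + d * u 14 * u 14 - c * d * u 15 * u 15)"
    "hodge a b c d l u 2 3 = - 2*a*b * (u 0 * u 13 + d * sym_cof u 13)"
    "hodge a b c d l u 2 4 = - 2*a*b * (u 0 * u 14 + c * sym_cof u 14)"
    "hodge a b c d l u 2 5 = - 2*a*b * (u 0 * u 15 - sym_cof u 15)"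
  unfolding hodge_def Let_def p_def[symmetric] by simp_all

text \<open>Write T(v) = u v~ u / l, so that w_i = l (e_i + T(e_i)). As T is an involutive isometry,
  B(w_i, w_j) = 2 l B(e_i, w_j), and this is 2 l B(e_i, e_i) times the i-th coordinate of
  w_j.\<close>

lemma bil_hodge:
  fixes a b c d l :: "'a::field" and u :: "nat \<Rightarrow> 'a"
  defines "B \<equiv> bil (albert a b c d)" and "w \<equiv> hodge a b c d l u"
  assumes N: "l^2 = sym_nrd a b c d u"
  shows "B (w 0) (w 0) = 2 * l * a * w 0 0" "B (w 0) (w 1) = 2 * l * a * w 1 0"
    "B (w 0) (w 2) = 2 * l * a * w 2 0" "B (w 1) (w 0) = 2 * l * b * w 0 1"
    "B (w 1) (w 1) = 2 * l * b * w 1 1" "B (w 1) (w 2) = 2 * l * b * w 2 1"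
    "B (w 2) (w 0) = - 2 * l * a * b * w 0 2" "B (w 2) (w 1) = - 2 * l * a * b * w 1 2"
    "B (w 2) (w 2) = - 2 * l * a * b * w 2 2"
proof -
  \<comment> \<open>The assumption on \<open>l\<close> enters through an explicit multiple of
    \<open>sym_nrd a b c d u - l^2\<close>, which leaves pure polynomial identities to
    check.\<close>
  have diag: "B (w 0) (w 0) = 2 * l * a * w 0 0 + (sym_nrd a b c d u - l^2) * a"
    "B (w 1) (w 1) = 2 * l * b * w 1 1 + (sym_nrd a b c d u - l^2) * b"
    "B (w 2) (w 2) = - 2 * l * a * b * w 2 2 - (sym_nrd a b c d u - l^2) * a * b"
    unfolding B_def w_def bil_albert hodge_nth sym_nrd_nth by Groebner_Basis.algebra+
  then show "B (w 0) (w 0) = 2 * l * a * w 0 0" "B (w 1) (w 1) = 2 * l * b * w 1 1"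
    "B (w 2) (w 2) = - 2 * l * a * b * w 2 2"
    unfolding N by simp_all
qed (unfold B_def w_def bil_albert hodge_nth sym_nrd_nth, Groebner_Basis.algebra+)

text \<open>By \<open>bil_hodge\<close> the Gram matrix is 2 l times the diagonal matrix of a, b,
  -ab times the transpose of the block of the first three coordinates. Modulo l^2 = Nrd u, the
  determinant of this block is twice a square.\<close>

lemma gram_det3_hodge:
  assumes N: "l^2 = sym_nrd a b c d u"
  shows "gram_det3 (albert a b c d) (hodge a b c d l u) =
    - l * (4 * l * a * b * ((l + (u 0)^2 - sym_sq a b c d u) * u 0 + 2 * a * b * c * d * sym_det u))^2"
proof -
  let ?w = "hodge a b c d l u"
  define p where "p = l + (u 0)^2 - sym_sq a b c d u"
  define z where "z = p * u 0 + 2 * a * b * c * d * sym_det u"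
  have "gram_det3 (albert a b c d) ?w = - 8 * l^3 * a^2 * b^2 *
      (?w 0 0 * (?w 1 1 * ?w 2 2 - ?w 1 2 * ?w 2 1) - ?w 0 1 * (?w 1 0 * ?w 2 2 - ?w 1 2 * ?w 2 0)
       + ?w 0 2 * (?w 1 0 * ?w 2 1 - ?w 1 1 * ?w 2 0))"
    unfolding gram_det3_def det_mat_3 prod.case bil_hodge[OF N] by Groebner_Basis.algebra
  also have "?w 0 0 * (?w 1 1 * ?w 2 2 - ?w 1 2 * ?w 2 1) - ?w 0 1 * (?w 1 0 * ?w 2 2 - ?w 1 2 * ?w 2 0)
       + ?w 0 2 * (?w 1 0 * ?w 2 1 - ?w 1 1 * ?w 2 0)
     = 2 * z^2 + p * (l^2 - sym_nrd a b c d u)"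
    unfolding z_def p_def hodge_nth sym_nrd_nth by Groebner_Basis.algebra
  finally have "gram_det3 (albert a b c d) ?w = - l * (4 * l * a * b * z)^2"
    unfolding N by (simp add: power2_eq_square power3_eq_cube)
  then show ?thesis unfolding z_def p_def .
qed

text \<open>The coordinates of \<open>v u v\<close> for a skew \<open>v\<close> and a symmetric \<open>u\<close> with scalar part \<open>0\<close>.\<close>

definition twist :: "'a::field \<Rightarrow> 'a \<Rightarrow> 'a \<Rightarrow> 'a \<Rightarrow> (nat \<Rightarrow> 'a) \<Rightarrow> (nat \<Rightarrow> 'a) \<Rightarrow> nat \<Rightarrow> 'a" where
  "twist a b c d v u =
    (let P = (\<lambda>l. a * v 0 * u (4 + l) + b * v 1 * u (8 + l) - a * b * v 2 * u (12 + l));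
         Q = (\<lambda>k. c * v 3 * u (4 * k + 1) + d * v 4 * u (4 * k + 2) - c * d * v 5 * u (4 * k + 3));
         R = (\<lambda>k l. [0, - b * (v 1 * u (12 + l) - v 2 * u (8 + l)), - a * (v 2 * u (4 + l) - v 0 * u (12 + l)),
                 v 0 * u (8 + l) - v 1 * u (4 + l)] ! k);
         S = (\<lambda>k l. [0, - d * (v 4 * R k 3 - v 5 * R k 2), - c * (v 5 * R k 1 - v 3 * R k 3),
                 v 3 * R k 2 - v 4 * R k 1] ! l);
         n = a * (v 0)^2 + b * (v 1)^2 - a * b * (v 2)^2 + c * (v 3)^2 + d * (v 4)^2 - c * d * (v 5)^2;
         M = (\<lambda>k l. 2 * v (k - 1) * P l + 2 * Q k * v (l + 2) - n * u (4 * k + l) - 2 * S k l)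
     in (!) [2 * (c * v 3 * P 1 + d * v 4 * P 2 - c * d * v 5 * P 3), 0, 0, 0, 0,
             M 1 1, M 1 2, M 1 3, 0, M 2 1, M 2 2, M 2 3, 0, M 3 1, M 3 2, M 3 3])"

text \<open>For v = e_i + f_j the scalar part of v u v isolates a single coordinate of u, so a
  nonzero coordinate can be turned into a nonzero scalar part.\<close>

lemma twist_0:
  assumes ij: "i < 3" "j < 3" and v: "v = (\<lambda>r. if r = i \<or> r = j + 3 then 1 else 0)"
  shows "twist a b c d v u 0 = 2 * [a, b, - (a * b)] ! i * [c, d, - (c * d)] ! j * u (4 * i + j + 5)"
  using less_3_cases[OF ij(1)] less_3_cases[OF ij(2)]
  unfolding v by (elim disjE; simp add: twist_def Let_def)

text \<open>The reduced norm of v is B(v, v)^2, and it occurs twice in v u v. Only the nine vectors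
  e_i + f_j are wanted, which keeps the polynomial identities small.\<close>

lemma sym_nrd_twist:
  assumes u: "u 0 = 0" and ij: "i < 3" "j < 3" and v: "v = (\<lambda>r. if r = i \<or> r = j + 3 then 1 else 0)"
  shows "sym_nrd a b c d (twist a b c d v u) = (bil (albert a b c d) v v)^4 * sym_nrd a b c d u"
proof -
  define v' where "v' i j r = (if r = i \<or> r = j + 3 then 1 else 0 :: 'a)" for i j r :: nat
  have "\<forall>i\<in>{0,1,2}. \<forall>j\<in>{0,1,2}.
      sym_nrd a b c d (twist a b c d (v' i j) u) = (bil (albert a b c d) (v' i j) (v' i j))^4 * sym_nrd a b c d u"
    unfolding ball_simps
    by (intro conjI TrueI; simp add: twist_def Let_def bil_albert v'_def; simp add: sym_nrd_nth u;
      Groebner_Basis.algebra)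
  moreover have "v = v' i j" by (simp add: v v'_def fun_eq_iff)
  ultimately show ?thesis using less_3_cases[OF ij(1)] less_3_cases[OF ij(2)] by blast
qed

section \<open>From three-dimensional subforms to symmetric elements\<close>

definition skew :: "(nat \<Rightarrow> 'a::field) \<Rightarrow> nat \<Rightarrow> 'a" where
  "skew v = (!) [0, v 3, v 4, v 5, v 0, 0, 0, 0, v 1, 0, 0, 0, v 2, 0, 0, 0]"

lemma bqrep_skew:
  "bqrep \<alpha> b \<gamma> d (skew v) = mat 4 4 (\<lambda>(i, j).
    [[\<alpha> * v 0 + \<gamma> * v 3, d * v 4 + \<gamma> * d * v 5, b * v 1 + \<alpha> * b * v 2, 0],
     [v 4 - \<gamma> * v 5, \<alpha> * v 0 - \<gamma> * v 3, 0, b * v 1 + \<alpha> * b * v 2],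
     [v 1 - \<alpha> * v 2, 0, - \<alpha> * v 0 + \<gamma> * v 3, d * v 4 + \<gamma> * d * v 5],
     [0, v 1 - \<alpha> * v 2, v 4 - \<gamma> * v 5, - \<alpha> * v 0 - \<gamma> * v 3]] ! i ! j)"
  by (rule mat_4_eqI, simp, simp, unfold ball_simps bqrep_def, intro conjI TrueI;
      simp add: sum_16 skew_def brep_def qrep_def)

text \<open>The map v to v~ of the overview. It is an isometry, and v v~ is the scalar B(v, v),
  which makes v_1 v_2~ v_3 behave like a product of vectors in a Clifford algebra.\<close>

definition conj_snd :: "(nat \<Rightarrow> 'a::field) \<Rightarrow> nat \<Rightarrow> 'a" where
  "conj_snd v r = (if r < 3 then v r else - v r)"

text \<open>The pure part of the product of two pure quaternions. The offset \<open>s\<close> is 0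
  for the coordinates of the first quaternion algebra and 3 for those of the second.\<close>

definition cross :: "'a::field \<Rightarrow> 'a \<Rightarrow> nat \<Rightarrow> (nat \<Rightarrow> 'a) \<Rightarrow> (nat \<Rightarrow> 'a) \<Rightarrow> nat \<Rightarrow> 'a" where
  "cross a b s v w k =
    (if k = 0 then - b * (v (s + 1) * w (s + 2) - v (s + 2) * w (s + 1))
     else if k = 1 then - a * (v (s + 2) * w s - v s * w (s + 2))
     else v s * w (s + 1) - v (s + 1) * w s)"

text \<open>The part of \<open>v\<^sub>1 v\<^sub>2~ v\<^sub>3\<close> that is alternating in the three vectors; the remaining part is a combination of the
  vectors with their inner products as coefficients.\<close>

definition triple :: "'a::field \<Rightarrow> 'a \<Rightarrow> 'a \<Rightarrow> 'a \<Rightarrow> (nat \<Rightarrow> 'a) \<Rightarrow> (nat \<Rightarrow> 'a) \<Rightarrow> (nat \<Rightarrow> 'a) \<Rightarrow> nat \<Rightarrow> 'a" where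
  "triple a b c d v1 v2 v3 m =
    (let U = cross a b 0; V = cross c d 3;
         M = (\<lambda>k l. U v1 v2 k * v3 (l + 3) + U v3 v1 k * v2 (l + 3) + U v2 v3 k * v1 (l + 3)
           - v1 k * V v2 v3 l - v2 k * V v3 v1 l - v3 k * V v1 v2 l)
     in if m = 0 then a * U v1 v2 0 * v3 0 + b * U v1 v2 1 * v3 1 - a * b * U v1 v2 2 * v3 2
          - c * V v1 v2 0 * v3 3 - d * V v1 v2 1 * v3 4 + c * d * V v1 v2 2 * v3 5
        else if m < 16 \<and> m div 4 \<noteq> 0 \<and> m mod 4 \<noteq> 0 then M (m div 4 - 1) (m mod 4 - 1) else 0)"

lemma symmetric_triple: "symmetric_coords (triple a b c d v1 v2 v3)"
  by (simp add: symmetric_coords_def triple_def Let_def)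

lemma triple_nth:
  fixes a b c d :: "'a::field"
  defines "U \<equiv> cross a b 0" and "V \<equiv> cross c d 3" and "t \<equiv> triple a b c d"
  shows "t v1 v2 v3 0 = a * U v1 v2 0 * v3 0 + b * U v1 v2 1 * v3 1 - a * b * U v1 v2 2 * v3 2
       - c * V v1 v2 0 * v3 3 - d * V v1 v2 1 * v3 4 + c * d * V v1 v2 2 * v3 5"
    "t v1 v2 v3 5 = U v1 v2 0 * v3 3 + U v3 v1 0 * v2 3 + U v2 v3 0 * v1 3
       - v1 0 * V v2 v3 0 - v2 0 * V v3 v1 0 - v3 0 * V v1 v2 0"
    "t v1 v2 v3 6 = U v1 v2 0 * v3 4 + U v3 v1 0 * v2 4 + U v2 v3 0 * v1 4
       - v1 0 * V v2 v3 1 - v2 0 * V v3 v1 1 - v3 0 * V v1 v2 1"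
    "t v1 v2 v3 7 = U v1 v2 0 * v3 5 + U v3 v1 0 * v2 5 + U v2 v3 0 * v1 5
       - v1 0 * V v2 v3 2 - v2 0 * V v3 v1 2 - v3 0 * V v1 v2 2"
    "t v1 v2 v3 9 = U v1 v2 1 * v3 3 + U v3 v1 1 * v2 3 + U v2 v3 1 * v1 3
       - v1 1 * V v2 v3 0 - v2 1 * V v3 v1 0 - v3 1 * V v1 v2 0"
    "t v1 v2 v3 10 = U v1 v2 1 * v3 4 + U v3 v1 1 * v2 4 + U v2 v3 1 * v1 4
       - v1 1 * V v2 v3 1 - v2 1 * V v3 v1 1 - v3 1 * V v1 v2 1"
    "t v1 v2 v3 11 = U v1 v2 1 * v3 5 + U v3 v1 1 * v2 5 + U v2 v3 1 * v1 5
       - v1 1 * V v2 v3 2 - v2 1 * V v3 v1 2 - v3 1 * V v1 v2 2"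
    "t v1 v2 v3 13 = U v1 v2 2 * v3 3 + U v3 v1 2 * v2 3 + U v2 v3 2 * v1 3
       - v1 2 * V v2 v3 0 - v2 2 * V v3 v1 0 - v3 2 * V v1 v2 0"
    "t v1 v2 v3 14 = U v1 v2 2 * v3 4 + U v3 v1 2 * v2 4 + U v2 v3 2 * v1 4
       - v1 2 * V v2 v3 1 - v2 2 * V v3 v1 1 - v3 2 * V v1 v2 1"
    "t v1 v2 v3 15 = U v1 v2 2 * v3 5 + U v3 v1 2 * v2 5 + U v2 v3 2 * v1 5
       - v1 2 * V v2 v3 2 - v2 2 * V v3 v1 2 - v3 2 * V v1 v2 2"
  unfolding U_def V_def t_def triple_def Let_def by simp_all

lemma cross_nth:
  "cross a b 0 v w 0 = - b * (v 1 * w 2 - v 2 * w 1)"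
  "cross a b 0 v w 1 = - a * (v 2 * w 0 - v 0 * w 2)"
  "cross a b 0 v w 2 = v 0 * w 1 - v 1 * w 0"
  "cross a b 3 v w 0 = - b * (v 4 * w 5 - v 5 * w 4)"
  "cross a b 3 v w 1 = - a * (v 5 * w 3 - v 3 * w 5)"
  "cross a b 3 v w 2 = v 3 * w 4 - v 4 * w 3"
  by (simp_all add: cross_def numeral_2_eq_2[symmetric] del: One_nat_def)

lemma conj_snd_nth: "conj_snd v 0 = v 0" "conj_snd v 1 = v 1" "conj_snd v 2 = v 2"
  "conj_snd v 3 = - v 3" "conj_snd v 4 = - v 4" "conj_snd v 5 = - v 5"
  by (simp_all add: conj_snd_def)

lemma skew_zero: "skew (\<lambda>r. 0) p = 0" if "p < 16"
  using that by (auto simp: skew_def numeral_eq_Suc less_Suc_eq)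

lemma bqrep_triple:
  fixes \<alpha> b \<gamma> d :: "'a::field"
  defines "B \<equiv> bil (albert (\<alpha> * \<alpha>) b (\<gamma> * \<gamma>) d)"
  assumes orth: "B v1 v2 = 0" "B v1 v3 = 0" "B v2 v3 = 0"
  shows "bqrep \<alpha> b \<gamma> d (skew v1) * bqrep \<alpha> b \<gamma> d (skew (conj_snd v2)) * bqrep \<alpha> b \<gamma> d (skew v3)
    = bqrep \<alpha> b \<gamma> d (triple (\<alpha> * \<alpha>) b (\<gamma> * \<gamma>) d v1 v2 v3)" (is "?L = ?R")
proof -
  have "?L = ?R + bqrep \<alpha> b \<gamma> d (skew (\<lambda>r. B v1 v2 * v3 r - B v1 v3 * v2 r + B v2 v3 * v1 r))"
    unfolding bqrep_sym[OF symmetric_triple] bqrep_skew mult_mat_4 add_mat_4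
    apply (rule mat_4_cong)
    unfolding B_def bil_albert ball_simps prod.case nth_list_4 triple_nth cross_nth conj_snd_nth
    by (intro conjI TrueI; Groebner_Basis.algebra)
  also have "bqrep \<alpha> b \<gamma> d (skew (\<lambda>r. B v1 v2 * v3 r - B v1 v3 * v2 r + B v2 v3 * v1 r)) = 0\<^sub>m 4 4"
    by (rule eq_matI) (auto simp: orth bqrep_def skew_zero)
  finally show ?thesis by simp
qed



lemma bil_conj_snd: "bil (albert a b c d) (conj_snd v) (conj_snd v) = bil (albert a b c d) v v"
  unfolding bil_albert conj_snd_nth by simp

lemma det_bqrep_skew:
  fixes \<alpha> b \<gamma> d :: "'a::field"
  shows "det (bqrep \<alpha> b \<gamma> d (skew v)) = (bil (albert (\<alpha> * \<alpha>) b (\<gamma> * \<gamma>) d) v v)^2"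
  unfolding bqrep_skew det_mat_4 prod.case nth_list_4 bil_albert by Groebner_Basis.algebra

lemma to_ac_bil: "to_ac (bil phi v w) = bil (map to_ac phi) (\<lambda>r. to_ac (v r)) (\<lambda>r. to_ac (w r))"
  by (simp add: bil_def to_ac_sum)

lemma to_ac_albert: "map to_ac (albert a b c d) = albert (to_ac a) (to_ac b) (to_ac c) (to_ac d)"
  by (simp add: albert_def)

lemma to_ac_triple: "to_ac (triple a b c d v1 v2 v3 m) = triple (to_ac a) (to_ac b) (to_ac c) (to_ac d)
    (\<lambda>r. to_ac (v1 r)) (\<lambda>r. to_ac (v2 r)) (\<lambda>r. to_ac (v3 r)) m"
  by (simp add: triple_def cross_def Let_def)

text \<open>Over the closure the element is the product of three matrices, and the determinant of
  each factor is the square of its value under B; the tilde on the middle factor does not change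
  that value.\<close>

lemma sym_nrd_triple:
  fixes a b c d :: "'a::field"
  defines "B \<equiv> bil (albert a b c d)"
  assumes orth: "B v1 v2 = 0" "B v1 v3 = 0" "B v2 v3 = 0"
  shows "sym_nrd a b c d (triple a b c d v1 v2 v3) = (B v1 v1 * B v2 v2 * B v3 v3)^2"
proof -
  obtain \<alpha> \<gamma> where \<alpha>: "to_ac a = \<alpha> * \<alpha>" and \<gamma>: "to_ac c = \<gamma> * \<gamma>"
    using nth_root_exists[of 2 "to_ac a"] nth_root_exists[of 2 "to_ac c"]
    unfolding power2_eq_square by (metis pos2)
  let ?b = "to_ac b" and ?d = "to_ac d"
  define w where "w v r = to_ac (v r)" for v :: "nat \<Rightarrow> 'a" and r
  have B: "to_ac (B v v') = bil (albert (\<alpha> * \<alpha>) ?b (\<gamma> * \<gamma>) ?d) (w v) (w v')" for v v'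
    unfolding B_def to_ac_bil to_ac_albert \<alpha> \<gamma> w_def ..
  have orth': "bil (albert (\<alpha> * \<alpha>) ?b (\<gamma> * \<gamma>) ?d) (w v1) (w v2) = 0"
    "bil (albert (\<alpha> * \<alpha>) ?b (\<gamma> * \<gamma>) ?d) (w v1) (w v3) = 0"
    "bil (albert (\<alpha> * \<alpha>) ?b (\<gamma> * \<gamma>) ?d) (w v2) (w v3) = 0"
    by (simp_all add: orth flip: B)
  have "to_ac (sym_nrd a b c d (triple a b c d v1 v2 v3))
      = sym_nrd (\<alpha> * \<alpha>) ?b (\<gamma> * \<gamma>) ?d (triple (\<alpha> * \<alpha>) ?b (\<gamma> * \<gamma>) ?d (w v1) (w v2) (w v3))"
    unfolding to_ac.sym_nrd_hom to_ac_triple w_def \<alpha> \<gamma> ..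
  also have "\<dots> = det (bqrep \<alpha> ?b \<gamma> ?d (triple (\<alpha> * \<alpha>) ?b (\<gamma> * \<gamma>) ?d (w v1) (w v2) (w v3)))"
    by (rule det_bqrep_sym[OF symmetric_triple, symmetric])
  also have "\<dots> = det (bqrep \<alpha> ?b \<gamma> ?d (skew (w v1))) * det (bqrep \<alpha> ?b \<gamma> ?d (skew (conj_snd (w v2)))) *
      det (bqrep \<alpha> ?b \<gamma> ?d (skew (w v3)))"
    unfolding bqrep_triple[OF orth', symmetric] det_mult[OF bqrep_carrier bqrep_carrier]
      det_mult[OF mult_carrier_mat[OF bqrep_carrier bqrep_carrier] bqrep_carrier] ..
  also have "\<dots> = to_ac ((B v1 v1 * B v2 v2 * B v3 v3)^2)"
    unfolding det_bqrep_skew bil_conj_snd by (simp add: B power_mult_distrib)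
  finally show ?thesis by (simp only: to_ac_eq_iff)
qed

lemma exists_sym_nrd:
  fixes a b c d :: "'a::field"
  defines "B \<equiv> bil (albert a b c d)"
  assumes two: "(2::'a) \<noteq> 0" and nz: "a \<noteq> 0" "b \<noteq> 0" "c \<noteq> 0" "d \<noteq> 0"
    and orth: "B v1 v2 = 0" "B v1 v3 = 0" "B v2 v3 = 0"
  shows "\<exists>u\<in>bq_Sym. bq_Nrd a b c d u = s^4 * (B v1 v1 * B v2 v2 * B v3 v3)^2"
proof -
  let ?u = "\<lambda>m. s * triple a b c d v1 v2 v3 m"
  have "symmetric_coords ?u" using symmetric_triple[of a b c d v1 v2 v3] by (simp add: symmetric_coords_def)
  then have u: "?u \<in> bq_Sym" by (rule bq_SymI) (simp add: triple_def Let_def)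
  have "bq_Nrd a b c d ?u = s^4 * (B v1 v1 * B v2 v2 * B v3 v3)^2"
    using orth unfolding bq_Nrd_sym[OF two nz u] sym_nrd_scale B_def by (simp add: sym_nrd_triple)
  with u show ?thesis by blast
qed

section \<open>Orthogonal bases in anisotropic spaces\<close>

lemma anisotropicD: "anisotropic phi \<Longrightarrow> bil phi v v = 0 \<Longrightarrow> r < length phi \<Longrightarrow> v r = 0"
  by (simp add: anisotropic_def qf_val_bil)

lemma anisotropic_bil_0:
  assumes "anisotropic phi" "bil phi v v = 0"
  shows "bil phi v w = 0"
  unfolding bil_def using anisotropicD[OF assms] by (intro sum.neutral) auto

text \<open>Gram-Schmidt orthogonalisation. A vanishing pivot would belong to an isotropic, hence
  zero, vector and would kill the Gram determinant. The base change is unitriangular, so the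
  determinant is preserved exactly and not merely up to squares.\<close>

lemma exists_orthogonal_basis3:
  assumes aniso: "anisotropic phi" and nz: "gram_det3 phi w \<noteq> 0"
  obtains f r0 r1 r2 where "frame phi [r0, r1, r2] f" "r0 * r1 * r2 = gram_det3 phi w"
proof -
  define g where "g i j = bil phi (w i) (w j)" for i j
  have sym: "g 1 0 = g 0 1" "g 2 0 = g 0 2" "g 2 1 = g 1 2" unfolding g_def by (rule bil_commute)+
  have gram: "gram_det3 phi w = g 0 0 * (g 1 1 * g 2 2 - g 1 2 * g 1 2) - g 0 1 * (g 0 1 * g 2 2 - g 1 2 * g 0 2)
      + g 0 2 * (g 0 1 * g 1 2 - g 1 1 * g 0 2)"
    unfolding gram_det3_def det_mat_3 prod.case g_def[symmetric] sym ..
  have "g 0 0 \<noteq> 0"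
  proof
    assume "g 0 0 = 0"
    then have "g 0 0 = 0" "g 0 1 = 0" "g 0 2 = 0"
      using anisotropic_bil_0[OF aniso, of "w 0"] by (auto simp: g_def)
    then show False using nz by (simp add: gram)
  qed
  define k where "k = - g 0 1 / g 0 0"
  have k: "k * g 0 0 = - g 0 1" using \<open>g 0 0 \<noteq> 0\<close> by (simp add: k_def)
  define v1 where "v1 = (\<lambda>r. w 1 r + k * w 0 r)"
  have v1: "bil phi (w 0) v1 = 0" "bil phi v1 v1 = g 1 1 + k * g 0 1" "bil phi (w 2) v1 = g 1 2 + k * g 0 2"
    using k by (simp_all add: v1_def bil_linear sym[unfolded One_nat_def] algebra_simps flip: g_def)
  define r1 where "r1 = g 1 1 + k * g 0 1"
  define e where "e = g 1 2 + k * g 0 2"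
  have det: "gram_det3 phi w = g 0 0 * (r1 * g 2 2 - e * e) - r1 * g 0 2 * g 0 2"
    unfolding gram r1_def e_def using k by Groebner_Basis.algebra
  have "r1 \<noteq> 0"
  proof
    assume "r1 = 0"
    then have "bil phi v1 v1 = 0" by (simp add: v1 r1_def)
    then have "bil phi v1 (w 2) = 0" by (rule anisotropic_bil_0[OF aniso])
    then have "e = 0" using v1(3) by (simp add: e_def bil_commute)
    with \<open>r1 = 0\<close> show False using nz det by simp
  qed
  define m where "m = - g 0 2 / g 0 0"
  define n where "n = - e / r1"
  have m: "m * g 0 0 = - g 0 2" and n: "n * r1 = - e"
    using \<open>g 0 0 \<noteq> 0\<close> \<open>r1 \<noteq> 0\<close> by (simp_all add: m_def n_def)
  define v2 where "v2 = (\<lambda>r. (w 2 r + m * w 0 r) + n * v1 r)"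
  have v1': "bil phi v1 (w 0) = 0" "bil phi v1 (w 2) = e" "bil phi (w 2) v1 = e" "bil phi v1 v1 = r1"
    using v1 by (simp_all add: bil_commute e_def r1_def)
  have v2: "bil phi (w 0) v2 = 0" "bil phi v1 v2 = 0" "bil phi v2 v2 = g 2 2 + m * g 0 2 + n * e"
    unfolding v2_def using m n v1' v1(1)
    by (simp_all add: bil_linear v1' v1(1) sym[unfolded One_nat_def] flip: g_def)
  have v2': "bil phi v2 (w 0) = 0" "bil phi v2 v1 = 0"
    using v2(1,2) by (simp_all add: bil_commute)
  define r2 where "r2 = g 2 2 + m * g 0 2 + n * e"
  have "frame phi [g 0 0, r1, r2] ((!) [w 0, v1, v2])"
    by (rule frameI)
      (auto simp: less_Suc_eq v1(1) v1' v2 v2' r2_def g_def)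
  moreover have "g 0 0 * r1 * r2 = gram_det3 phi w"
    unfolding det r2_def using m n by Groebner_Basis.algebra
  ultimately show ?thesis using that by blast
qed

lemma frame_extend:
  assumes aniso: "anisotropic phi" and f: "frame phi psi f" and len: "length psi < length phi"
  obtains x g where "x \<noteq> 0" "frame phi (psi @ [x]) g"
proof -
  define n where "n = length phi"
  \<comment> \<open>Orthogonality to the frame, padded with zero rows to a square system. There is
    at least one such row, so the system is singular and has a nonzero solution; anisotropy then
    makes its value nonzero.\<close>
  define A where "A = mat n n (\<lambda>(i, j). if i < length psi then phi ! j * f i j else 0)"
  have A: "A \<in> carrier_mat n n" by (simp add: A_def)
  have "det A = 0"
  proof -
    have "det A = (\<Sum>j<n. A $$ (length psi, j) * cofactor A (length psi) j)"
      using len by (intro laplace_expansion_row[OF A]) (simp add: n_def)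
    also have "\<dots> = 0" using len by (intro sum.neutral) (auto simp: A_def n_def)
    finally show ?thesis .
  qed
  then obtain v where v: "v \<in> carrier_vec n" "v \<noteq> 0\<^sub>v n" "A *\<^sub>v v = 0\<^sub>v n"
    using det_0_iff_vec_prod_zero[OF A] by blast
  define y where "y j = v $ j" for j
  define x where "x = bil phi y y"
  have "x \<noteq> 0"
  proof
    assume "x = 0"
    then have "v $ j = 0" if "j < n" for j
      using anisotropicD[OF aniso, of y j] that by (simp add: x_def y_def n_def)
    then show False using v(1,2) by (auto simp: vec_eq_iff)
  qed
  have orth: "bil phi (f i) y = 0" if "i < length psi" for i
  proof -
    have "bil phi (f i) y = (A *\<^sub>v v) $ i"
      using that len v(1) by (simp add: A_def n_def bil_def y_def scalar_prod_def atLeast0LessThan mult.assoc)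
    also have "\<dots> = 0" using that len v(3) by (simp add: n_def)
    finally show ?thesis .
  qed
  then have orth': "bil phi y (f i) = 0" if "i < length psi" for i
    using that by (subst bil_commute) simp
  have "frame phi (psi @ [x]) (\<lambda>i. if i < length psi then f i else y)"
  proof (rule frameI)
    fix i j assume "i < length (psi @ [x])" "j < length (psi @ [x])"
    then show "bil phi (if i < length psi then f i else y) (if j < length psi then f j else y)
        = (if i = j then (psi @ [x]) ! i else 0)"
      using orth orth' frameD[OF f, of i j] by (auto simp: nth_append x_def less_Suc_eq)
  qed
  with \<open>x \<noteq> 0\<close> show ?thesis using that by blast
qed

section \<open>Sums of two Pfister forms\<close>

text \<open>Selecting part of a frame, permuting it and changing its values by squares are covered
  together.\<close>

lemma frame_reindex:
  assumes f: "frame phi psi f" and inj: "inj_on \<sigma> {..<length chi}"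
    and \<sigma>: "\<And>i. i < length chi \<Longrightarrow> \<sigma> i < length psi"
    and chi: "\<And>i. i < length chi \<Longrightarrow> chi ! i = (s i)^2 * psi ! \<sigma> i"
  shows "frame phi chi (\<lambda>i r. s i * f (\<sigma> i) r)"
proof (rule frameI)
  fix i j assume ij: "i < length chi" "j < length chi"
  then have "\<sigma> i = \<sigma> j \<longleftrightarrow> i = j" using inj by (auto simp: inj_on_def)
  then show "bil phi (\<lambda>r. s i * f (\<sigma> i) r) (\<lambda>r. s j * f (\<sigma> j) r) = (if i = j then chi ! i else 0)"
    using frameD[OF f, of "\<sigma> i" "\<sigma> j"] \<sigma> chi ij by (simp add: bil_linear power2_eq_square)
qed

lemma frame_refl: "frame phi phi (\<lambda>i r. if r = i then 1 else 0)"
proof (rule frameI)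
  fix i j assume "i < length phi" "j < length phi"
  moreover have "(\<Sum>r<length phi. phi ! r * ((if r = i then 1 else 0) * (if r = j then 1 else 0)))
      = (\<Sum>r<length phi. if r = i then (if i = j then phi ! i else 0) else 0)"
    by (intro sum.cong) auto
  ultimately show "bil phi (\<lambda>r. if r = i then 1 else 0) (\<lambda>r. if r = j then 1 else 0) = (if i = j then phi ! i else 0)"
    by (simp add: bil_def)
qed

lemma frame_rescale:
  assumes "length chi = length phi" "\<And>i. i < length chi \<Longrightarrow> chi ! i = (s i)^2 * phi ! i"
  shows "\<exists>f. frame phi chi f"
  using frame_reindex[OF frame_refl, of "\<lambda>i. i" chi phi s] assms by auto

lemma frame_mset:
  assumes f: "frame phi psi f" and "mset chi = mset psi"
  shows "\<exists>g. frame phi chi g"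
proof -
  obtain p where p: "p permutes {..<length psi}" "permute_list p psi = chi"
    using mset_eq_permutation[OF assms(2)] by blast
  have len: "length chi = length psi" using assms(2) by (rule mset_eq_length)
  have "frame phi chi (\<lambda>i r. 1 * f (p i) r)"
  proof (rule frame_reindex[OF f])
    show "inj_on p {..<length chi}" using p(1) by (simp add: permutes_inj_on)
    show "p i < length psi" if "i < length chi" for i
      using that permutes_in_image[OF p(1), of i] len by auto
    show "chi ! i = 1^2 * psi ! p i" if "i < length chi" for i
      using p that len by (auto simp: permute_list_nth)
  qed
  then show ?thesis by blast
qed

lemma nth_scale_qf: "i < length phi \<Longrightarrow> scale_qf l phi ! i = l * phi ! i"
  by (simp add: scale_qf_def)

lemma frame_scale_qf:
  assumes "frame phi psi f"
  shows "frame (scale_qf l phi) (scale_qf l psi) f"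
  using frameD[OF assms] by (intro frameI) (auto simp: bil_scale_qf nth_scale_qf)

lemma anisotropic_of_frame:
  assumes f: "frame phi psi f" and aniso: "anisotropic phi" and nz: "0 \<notin> set psi"
  shows "anisotropic psi"
  unfolding anisotropic_def qf_val_bil
proof (intro allI impI)
  fix v i assume v: "bil psi v v = 0" and i: "i < length psi"
  let ?F = "\<lambda>v r. \<Sum>k<length psi. v k * f k r"
  have "bil phi (?F v) (?F v) = 0" using v by (simp add: bil_frame[OF f])
  then have "bil phi (?F v) (?F (\<lambda>r. if r = i then 1 else 0)) = 0"
    by (rule anisotropic_bil_0[OF aniso])
  then have "bil psi v (\<lambda>r. if r = i then 1 else 0) = 0" by (simp only: bil_frame[OF f])
  then have "psi ! i * v i = 0" using i by (simp add: bil_def if_distrib cong: if_cong)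
  moreover have "psi ! i \<noteq> 0" using nz nth_mem[OF i] by metis
  ultimately show "v i = 0" by simp
qed

lemma anisotropic_scale_qf: "anisotropic phi \<Longrightarrow> l \<noteq> 0 \<Longrightarrow> anisotropic (scale_qf l phi)"
  by (simp add: anisotropic_def qf_val_bil bil_scale_qf)

lemma hyp_add: "hyp (m + n) = hyp m @ hyp n"
  by (simp add: hyp_def replicate_add)

text \<open>Cancellation would leave \<open>phi\<close> isometric to \<open>psi\<close> plus at
  least one hyperbolic plane, where vectors of values 1 and -1 add up to an isotropic one. It
  excludes fewer than two Pfister forms for a form of dimension six.\<close>

lemma not_witt_equiv_smaller:
  fixes phi psi :: "'a::field list"
  assumes two: "(2::'a) \<noteq> 0" and aniso: "anisotropic phi" and len: "length psi < length phi"
  shows "\<not> witt_equiv phi psi"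
proof
  assume "witt_equiv phi psi"
  then obtain m n where "qf_isometric (phi @ hyp m) (psi @ hyp n)" by (auto simp: witt_equiv_def)
  then obtain f where f: "frame (phi @ hyp m) (psi @ hyp n) f"
    and l: "length phi + 2 * m = length psi + 2 * n"
    by (auto elim: qf_isometric_frameE)
  from l len have "n = Suc (n - m - 1) + m" by linarith
  then obtain k where n: "n = Suc k + m" by blast
  let ?chi = "psi @ hyp (Suc k)"
  have "frame (phi @ hyp m) (?chi @ hyp m) f" using f by (simp only: n hyp_add append_assoc)
  moreover have "length phi = length ?chi" using l n by simp
  ultimately obtain g where g: "frame phi ?chi g" by (rule frame_cancel_hyp[OF two])
  let ?p = "length psi + 2 * k"
  let ?v = "\<lambda>r. g ?p r + g (Suc ?p) r"
  have chi: "?chi ! ?p = 1" "?chi ! Suc ?p = -1" by (simp_all add: hyp_Suc nth_append)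
  have p: "?p < length ?chi" "Suc ?p < length ?chi" by simp_all
  have B: "bil phi (g ?p) (g ?p) = 1" "bil phi (g ?p) (g (Suc ?p)) = 0"
    "bil phi (g (Suc ?p)) (g ?p) = 0" "bil phi (g (Suc ?p)) (g (Suc ?p)) = -1"
    using frameD[OF g p(1) p(1)] frameD[OF g p(1) p(2)] frameD[OF g p(2) p(1)] frameD[OF g p(2) p(2)] chi
    by simp_all
  have "bil phi ?v ?v = 0" by (simp add: bil_add_left bil_add_right B)
  then have "bil phi ?v (g ?p) = 0" by (rule anisotropic_bil_0[OF aniso])
  then show False by (simp add: bil_add_left B)
qed

text \<open>The eight-dimensional sum is the six-dimensional form plus its two entries 1, and
  \<langle>1, 1\<rangle> is hyperbolic because -1 is a square. Cancellation gives one direction,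
  adding a plane the other.\<close>

lemma frame_six_iff_witt_equiv:
  fixes phi :: "'a::field list"
  assumes two: "(2::'a) \<noteq> 0" and i: "i * i = (-1::'a)" and len: "length phi = 6"
    and nz: "x \<noteq> 0" "y \<noteq> 0" "z \<noteq> 0" "w \<noteq> 0"
  shows "witt_equiv phi (pfister2 x y @ pfister2 z w) \<longleftrightarrow> (\<exists>f. frame phi [x, y, x * y, z, w, z * w] f)"
proof
  let ?P = "pfister2 x y @ pfister2 z w" and ?Q = "[x, y, x * y, z, w, z * w]"
  assume "witt_equiv phi ?P"
  then obtain m n where "qf_isometric (phi @ hyp m) (?P @ hyp n)" by (auto simp: witt_equiv_def)
  then obtain f where f: "frame (phi @ hyp m) (?P @ hyp n) f" and l: "length phi + 2 * m = 8 + 2 * n"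
    by (auto simp: pfister2_def elim!: qf_isometric_frameE)
  then have "m = 1 + n" using len by simp
  then have "frame ((phi @ hyp 1) @ hyp n) (?P @ hyp n) f"
    using f by (simp only: hyp_add append_assoc)
  moreover have "length (phi @ hyp 1) = length ?P" by (simp add: len pfister2_def)
  ultimately obtain g where g: "frame (phi @ hyp 1) ?P g" by (rule frame_cancel_hyp[OF two])
  \<comment> \<open>The index list moves the two entries 1, at positions 0 and 4, to the end; the
    factor \<open>i\<close> turns the second one into -1.\<close>
  have "frame (phi @ hyp 1) (?Q @ hyp 1)
      (\<lambda>k r. (if k = 7 then i else 1) * g ((!) [1, 2, 3, 5, 6, 7, 0, 4 :: nat] k) r)"
  proof (rule frame_reindex[OF g])
    show "inj_on ((!) [1, 2, 3, 5, 6, 7, 0, 4 :: nat]) {..<length (?Q @ hyp 1)}"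
      by (rule inj_on_nth) (auto simp: hyp_def)
    fix k assume "k < length (?Q @ hyp 1)"
    then have "k = 0 \<or> k = 1 \<or> k = 2 \<or> k = 3 \<or> k = 4 \<or> k = 5 \<or> k = 6 \<or> k = 7" by simp linarith
    then show "[1, 2, 3, 5, 6, 7, 0, 4 :: nat] ! k < length ?P"
      and "(?Q @ hyp 1) ! k = (if k = 7 then i else 1)\<^sup>2 * ?P ! ([1, 2, 3, 5, 6, 7, 0, 4 :: nat] ! k)"
      using i by (auto simp: pfister2_def hyp_def power2_eq_square)
  qed
  moreover have "length phi = length ?Q" by (simp add: len)
  ultimately obtain h where "frame phi ?Q h" by (rule frame_cancel_hyp[OF two])
  then show "\<exists>f. frame phi ?Q f" by blast
next
  let ?P = "pfister2 x y @ pfister2 z w" and ?Q = "[x, y, x * y, z, w, z * w]"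
  assume "\<exists>f. frame phi ?Q f"
  then obtain f where "frame phi ?Q f" ..
  from frame_append[OF this frame_refl[of "hyp 1"]]
  obtain g where g: "frame (phi @ hyp 1) (?Q @ hyp 1) g" by blast
  have "frame (phi @ hyp 1) (?P @ hyp 0) (\<lambda>k r. (if k = 4 then i else 1) * g ((!) [6, 0, 1, 2, 7, 3, 4, 5 :: nat] k) r)"
  proof (rule frame_reindex[OF g])
    show "inj_on ((!) [6, 0, 1, 2, 7, 3, 4, 5 :: nat]) {..<length (?P @ hyp 0)}"
      by (rule inj_on_nth) (auto simp: hyp_def pfister2_def)
    fix k assume "k < length (?P @ hyp 0)"
    then have "k = 0 \<or> k = 1 \<or> k = 2 \<or> k = 3 \<or> k = 4 \<or> k = 5 \<or> k = 6 \<or> k = 7" by (simp add: pfister2_def) linarith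
    then show "[6, 0, 1, 2, 7, 3, 4, 5 :: nat] ! k < length (?Q @ hyp 1)"
      and "(?P @ hyp 0) ! k = (if k = 4 then i else 1)\<^sup>2 * (?Q @ hyp 1) ! ([6, 0, 1, 2, 7, 3, 4, 5 :: nat] ! k)"
      using i by (auto simp: pfister2_def hyp_def power2_eq_square)
  qed
  moreover have "length (phi @ hyp 1) = length (?P @ hyp 0)" by (simp add: len pfister2_def)
  moreover have "0 \<notin> set (?P @ hyp 0)" using nz by (simp add: pfister2_def hyp_def)
  ultimately have "qf_isometric (phi @ hyp 1) (?P @ hyp 0)" by (rule qf_isometric_frameI)
  then show "witt_equiv phi ?P" unfolding witt_equiv_def by blast
qed

text \<open>The hyperbolic plane represents x = s^2 - t^2, with s and t determined by s + t = x and
  s - t = 1. Multiplying the swapped vector (t, s) by the square root of -1 gives an orthogonal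
  vector of the same value.\<close>

lemma frame_hyp_doubled:
  fixes xs :: "'a::field list"
  assumes two: "(2::'a) \<noteq> 0" and i: "i * i = (-1::'a)"
  shows "\<exists>f. frame (hyp (length xs)) (concat (map (\<lambda>x. [x, x]) xs)) f"
proof (induction xs)
  case Nil
  have "frame (hyp 0) [] (\<lambda>_ _. 0 :: 'a)" by (simp add: frame_def)
  then show ?case by auto
next
  case (Cons x xs)
  define s where "s = (x + 1) / 2"
  define t where "t = (x - 1) / 2"
  have "s + t = (2 * x) / 2" "s - t = 2 / 2"
    by (simp_all add: s_def t_def flip: add_divide_distrib diff_divide_distrib)
  then have st: "s + t = x" "s - t = 1" using two by simp_all
  have "s * s - t * t = (s + t) * (s - t)" by (simp add: algebra_simps)
  then have st: "s * s - t * t = x" unfolding st by simp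
  define g where "g k r = (if k = (0::nat) then if r = (0::nat) then s else t else if r = 0 then i * t else i * s)" for k r
  have sq: "i * p * (i * q) = - (p * q)" for p q
  proof -
    have "i * p * (i * q) = i * i * (p * q)" by (simp only: ac_simps)
    then show ?thesis by (simp add: i)
  qed
  have "frame [1, -1] [x, x] g"
  proof (rule frameI)
    fix k l assume "k < length [x, x]" "l < length [x, x]"
    then have "k = 0 \<or> k = 1" "l = 0 \<or> l = 1" by auto
    then show "bil [1, -1] (g k) (g l) = (if k = l then [x, x] ! k else 0)"
      using st by (auto simp: bil_def g_def numeral_2_eq_2 sq)
  qed
  moreover obtain f where "frame (hyp (length xs)) (concat (map (\<lambda>x. [x, x]) xs)) f" using Cons ..
  ultimately have "\<exists>h. frame ([1, -1] @ hyp (length xs)) ([x, x] @ concat (map (\<lambda>x. [x, x]) xs)) h"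
    using frame_append by blast
  then show ?case by (simp add: hyp_def)
qed

text \<open>The fixed vectors \<open>hodge\<close> may be dependent. This can be repaired by passing to \<open>-l\<close> if the
  scalar part of \<open>u\<close> is nonzero, and otherwise by first replacing \<open>u\<close> by \<open>v u v\<close>, which multiplies the
  reduced norm by \<open>q(v)\<^sup>4\<close>, for a suitable vector \<open>v\<close>.\<close>

lemma exists_gram_det3:
  fixes a b c d l :: "'a::field"
  assumes two: "(2::'a) \<noteq> 0" and i: "i * i = (-1::'a)" and nz: "a \<noteq> 0" "b \<noteq> 0" "c \<noteq> 0" "d \<noteq> 0"
    and aniso: "anisotropic (albert a b c d)" and l: "l \<noteq> 0" and N: "l^2 = sym_nrd a b c d u"
  shows "\<exists>w s. s \<noteq> 0 \<and> gram_det3 (albert a b c d) w = l * s^2"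
proof -
  define h where "h l u = (l + (u 0)^2 - sym_sq a b c d u) * u 0 + 2 * a * b * c * d * sym_det u" for l u
  have generic: "\<exists>w s. s \<noteq> 0 \<and> gram_det3 (albert a b c d) w = l * s^2"
    if N: "l^2 = sym_nrd a b c d u" and l: "l \<noteq> 0" and h: "h l u \<noteq> 0" for l u
  proof (intro exI conjI)
    \<comment> \<open>The square root \<open>i\<close> of -1 absorbs the minus sign of
      \<open>gram_det3_hodge\<close> into the square.\<close>
    show "gram_det3 (albert a b c d) (hodge a b c d l u) = l * (4 * l * a * b * i * h l u)^2"
      unfolding gram_det3_hodge[OF N] h_def[symmetric] using i by Groebner_Basis.algebra
    have "(4::'a) = 2 * 2" by simp
    then have "(4::'a) \<noteq> 0" using two by (metis mult_eq_0_iff)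
    moreover have "i \<noteq> 0" using i by auto
    ultimately show "4 * l * a * b * i * h l u \<noteq> 0" using nz l h by simp
  qed
  have nonzero_scalar: "\<exists>w s. s \<noteq> 0 \<and> gram_det3 (albert a b c d) w = l * s^2"
    if N: "l^2 = sym_nrd a b c d u" and l: "l \<noteq> 0" and t: "u 0 \<noteq> 0" for l u
  proof (cases "h l u = 0")
    case False
    then show ?thesis using generic[OF N l] by blast
  next
    case True
    have "h (- l) u = h l u - 2 * l * u 0" by (simp add: h_def algebra_simps)
    then have "h (- l) u \<noteq> 0" using True two l t by simp
    then obtain w s where s: "s \<noteq> 0" and w: "gram_det3 (albert a b c d) w = - l * s^2"
      using generic[of "- l" u] N l by auto
    have "- l * s^2 = l * (i * s)^2" using i by Groebner_Basis.algebra
    moreover have "i * s \<noteq> 0" using i s by auto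
    ultimately show ?thesis using w by metis
  qed
  show ?thesis
  proof (cases "u 0 = 0 \<and> h l u = 0")
    case False
    then show ?thesis using generic[OF N l] nonzero_scalar[OF N l] by blast
  next
    case True
    then have t: "u 0 = 0" by blast
    have "\<exists>k<3. \<exists>m<3. u (4 * k + m + 5) \<noteq> 0"
    proof (rule ccontr)
      assume "\<not> ?thesis"
      then have u: "u (4 * k + m + 5) = 0" if "k < 3" "m < 3" for k m using that by blast
      have "u 5 = 0" "u 6 = 0" "u 7 = 0" "u 9 = 0" "u 10 = 0" "u 11 = 0" "u 13 = 0" "u 14 = 0" "u 15 = 0"
        using u[of 0 0] u[of 0 1] u[of 0 2] u[of 1 0] u[of 1 1] u[of 1 2] u[of 2 0] u[of 2 1] u[of 2 2]
        by simp_all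
      then have "sym_nrd a b c d u = 0" by (simp add: sym_nrd_nth t)
      then show False using N l by simp
    qed
    then obtain k m where km: "k < 3" "m < 3" and ukm: "u (4 * k + m + 5) \<noteq> 0" by blast
    define v where "v = (\<lambda>r. if r = k \<or> r = m + 3 then 1 else 0 :: 'a)"
    define e where "e = bil (albert a b c d) v v"
    have e: "e \<noteq> 0"
      using anisotropicD[OF aniso, of v k] km unfolding e_def by (auto simp: v_def)
    let ?u = "twist a b c d v u"
    have "(e^2 * l)^2 = sym_nrd a b c d ?u"
      unfolding sym_nrd_twist[where v = v and u = u, OF t km v_def] e_def[symmetric] N[symmetric] by Groebner_Basis.algebra
    moreover have "?u 0 \<noteq> 0"
      unfolding twist_0[where v = v, OF km v_def] using two nz ukm less_3_cases[OF km(1)] less_3_cases[OF km(2)] by auto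
    ultimately obtain w s where s: "s \<noteq> 0" and w: "gram_det3 (albert a b c d) w = e^2 * l * s^2"
      using nonzero_scalar[of "e^2 * l" ?u] e l by auto
    have "e^2 * l * s^2 = l * (e * s)^2" by Groebner_Basis.algebra
    then show ?thesis using s e w by (metis mult_eq_0_iff)
  qed
qed

lemma frame_of_sym_nrd:
  fixes a b c d l :: "'a::field"
  assumes two: "(2::'a) \<noteq> 0" and i: "i * i = (-1::'a)" and nz: "a \<noteq> 0" "b \<noteq> 0" "c \<noteq> 0" "d \<noteq> 0"
    and aniso: "anisotropic (albert a b c d)" and l: "l \<noteq> 0" and N: "l^2 = sym_nrd a b c d u"
  obtains x y z w f where "x \<noteq> 0" "y \<noteq> 0" "z \<noteq> 0" "w \<noteq> 0"
    "frame (scale_qf l (albert a b c d)) [x, y, x * y, z, w, z * w] f"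
proof -
  let ?Q = "albert a b c d"
  obtain w s where s: "s \<noteq> 0" and w: "gram_det3 ?Q w = l * s^2"
    using exists_gram_det3[OF assms] by blast
  have "gram_det3 ?Q w \<noteq> 0" using w s l by simp
  then obtain f r0 r1 r2 where f: "frame ?Q [r0, r1, r2] f" and r: "r0 * r1 * r2 = l * s^2"
    using exists_orthogonal_basis3[OF aniso, of w] w by metis
  obtain r3 g where r3: "r3 \<noteq> 0" and g: "frame ?Q ([r0, r1, r2] @ [r3]) g"
    using frame_extend[OF aniso f] by auto
  obtain r4 g' where r4: "r4 \<noteq> 0" and g': "frame ?Q (([r0, r1, r2] @ [r3]) @ [r4]) g'"
    using frame_extend[OF aniso g] by auto
  obtain r5 g'' where r5: "r5 \<noteq> 0" and "frame ?Q ((([r0, r1, r2] @ [r3]) @ [r4]) @ [r5]) g''"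
    using frame_extend[OF aniso g'] by auto
  then have F: "frame ?Q [r0, r1, r2, r3, r4, r5] g''" by simp
  have r012: "r0 \<noteq> 0" "r1 \<noteq> 0" "r2 \<noteq> 0" using r l s by auto
  obtain T where "(det T)^2 * prod_list ?Q = prod_list [r0, r1, r2, r3, r4, r5]"
    by (rule frame_congruence[OF F]) simp
  moreover define m where "m = det T"
  ultimately have "r0 * r1 * r2 * (r3 * r4 * r5) = m^2 * - ((a * b * c * d)^2)"
    by (simp add: albert_def power2_eq_square algebra_simps)
  then have "l * s^2 * (r3 * r4 * r5) = (m * i * a * b * c * d)^2"
    unfolding r using i by Groebner_Basis.algebra
  \<comment> \<open>The full determinant is a square since -1 is one, so \<open>r3 * r4 * r5\<close>
    lies in the same square class as \<open>r0 * r1 * r2\<close>, that of \<open>l\<close>;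
    \<open>q\<close> is the resulting square root.\<close>
  moreover define q where "q = m * i * a * b * c * d / (l * s)"
  moreover have "l * s * q = m * i * a * b * c * d" using l s by (simp add: q_def)
  ultimately have "(l * s^2) * (r3 * r4 * r5) = (l * s^2) * (l * q^2)" by Groebner_Basis.algebra
  then have "r3 * r4 * r5 = l * q^2" using l s by simp
  note r' = this
  have F': "frame (scale_qf l ?Q) [l * r0, l * r1, l * r2, l * r3, l * r4, l * r5] g''"
    using frame_scale_qf[OF F, of l] by (simp add: scale_qf_def)
  \<comment> \<open>Only the third entry of each half is rescaled: from
    \<open>r0 * r1 * r2 = l * s^2\<close> one gets
    \<open>(l * s / r2)^2 * (l * r2) = l * r0 * (l * r1)\<close>, and likewise with
    \<open>q\<close>.\<close>
  define e where "e k = (if k = (2::nat) then l * s / r2 else if k = 5 then l * q / r5 else 1)" for k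
  have "frame (scale_qf l ?Q) [l * r0, l * r1, l * r0 * (l * r1), l * r3, l * r4, l * r3 * (l * r4)]
      (\<lambda>k r. e k * g'' k r)"
  proof (rule frame_reindex[OF F'])
    fix k assume "k < length [l * r0, l * r1, l * r0 * (l * r1), l * r3, l * r4, l * r3 * (l * r4)]"
    then have "k = 0 \<or> k = 1 \<or> k = 2 \<or> k = 3 \<or> k = 4 \<or> k = 5" by simp linarith
    moreover have "l * r0 * (l * r1) = (l * s / r2)^2 * (l * r2)"
      using r r012 by (simp add: power2_eq_square divide_simps) (Groebner_Basis.algebra)
    moreover have "l * r3 * (l * r4) = (l * q / r5)^2 * (l * r5)"
      using r' r5 by (simp add: power2_eq_square divide_simps) (Groebner_Basis.algebra)
    ultimately show "[l * r0, l * r1, l * r0 * (l * r1), l * r3, l * r4, l * r3 * (l * r4)] ! k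
        = (e k)^2 * [l * r0, l * r1, l * r2, l * r3, l * r4, l * r5] ! k"
      by (elim disjE) (simp_all add: e_def)
  qed auto
  from that[OF _ _ _ _ this] show ?thesis using r012 r3 r4 l by simp
qed

text \<open>Without this, the minimum in \<open>Pf2\<close> could be taken over the empty set and hence be an arbitrary number.
  As \<open>-1\<close> is a square, \<open>\<langle>l\<rangle>\<langle>\<langle>a, b\<rangle>\<rangle> = \<langle>\<langle>a, b\<rangle>\<rangle> + \<langle>\<langle>l, a\<rangle>\<rangle> + \<langle>\<langle>l, b\<rangle>\<rangle> + \<langle>\<langle>l, ab\<rangle>\<rangle>\<close> in the Witt ring.\<close>

lemma exists_pfister_sum:
  fixes phi :: "'a::field list"
  assumes two: "(2::'a) \<noteq> 0" and i: "i * i = (-1::'a)" and nz: "a \<noteq> 0" "b \<noteq> 0" "c \<noteq> 0" "d \<noteq> 0" "l \<noteq> 0"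
    and len: "length phi = 6" and f: "frame phi (scale_qf l [a, b, a * b, c, d, c * d]) f"
  shows "\<exists>ps. (\<forall>(x, y)\<in>set ps. x \<noteq> 0 \<and> y \<noteq> 0) \<and> witt_equiv phi (concat (map (\<lambda>(x, y). pfister2 x y) ps))"
proof -
  define ps where "ps = [(a, b), (l, a), (l, b), (l, a * b), (c, d), (l, c), (l, d), (l, c * d)]"
  \<comment> \<open>The eight Pfister forms have 32 entries: the six of \<open>l\<close> times the
    form, and 26 that come in equal pairs. Each pair is a hyperbolic plane, one for each element of
    \<open>xs\<close>.\<close>
  define xs where "xs = [1, 1, 1, 1, a, b, a * b, l, l, l, c, d, c * d]"
  let ?P = "concat (map (\<lambda>(x, y). pfister2 x y) ps)" and ?Q = "scale_qf l [a, b, a * b, c, d, c * d]"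
  have nzP: "\<forall>(x, y)\<in>set ps. x \<noteq> 0 \<and> y \<noteq> 0" using nz by (simp add: ps_def)
  obtain g where "frame (hyp (length xs)) (concat (map (\<lambda>x. [x, x]) xs)) g"
    using frame_hyp_doubled[OF two i] by blast
  from frame_append[OF f this] obtain h where
    h: "frame (phi @ hyp (length xs)) (?Q @ concat (map (\<lambda>x. [x, x]) xs)) h" by blast
  have "mset ?P = mset (?Q @ concat (map (\<lambda>x. [x, x]) xs))"
    by (simp add: ps_def xs_def pfister2_def scale_qf_def)
  then obtain h' where "frame (phi @ hyp (length xs)) (?P @ hyp 0) h'"
    using frame_mset[OF h, of ?P] by (auto simp: hyp_def)
  moreover have "length (phi @ hyp (length xs)) = length (?P @ hyp 0)"
    by (simp add: len ps_def pfister2_def xs_def)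
  moreover have "0 \<notin> set (?P @ hyp 0)"
    using nz by (simp add: ps_def pfister2_def hyp_def)
  ultimately have "qf_isometric (phi @ hyp (length xs)) (?P @ hyp 0)" by (rule qf_isometric_frameI)
  then have "witt_equiv phi ?P" unfolding witt_equiv_def by blast
  with nzP show ?thesis by blast
qed

theorem theorem3p2:
  fixes q :: "'a::field list" and a b c d lam :: 'a
  assumes char: "(2::'a) \<noteq> 0"
    and sqrt_m1: "\<exists>i::'a. i * i = -1"
    and nz: "a \<noteq> 0" "b \<noteq> 0" "c \<noteq> 0" "d \<noteq> 0"
    and iso: "qf_isometric q [a, b, a * b, c, d, c * d]"
    and aniso: "anisotropic q"
    and lam: "lam \<noteq> 0"
  shows "Pf2 (scale_qf lam q) = 2 \<longleftrightarrow>
           (\<exists>u \<in> bq_Sym. lam ^ 2 = bq_Nrd a b c d u)"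
proof -
  obtain i :: 'a where i: "i * i = -1" using sqrt_m1 by blast
  let ?Q = "[a, b, a * b, c, d, c * d]" and ?A = "albert a b c d" and ?q = "scale_qf lam q"
  \<comment> \<open>The two diagonal forms differ by a sign exactly at the positions 2, 3 and
    4.\<close>
  define s where "s k = (if k \<in> {2, 3, 4 :: nat} then i else 1)" for k
  have s: "?A ! k = (s k)^2 * ?Q ! k" "?Q ! k = (s k)^2 * ?A ! k" if "k < 6" for k
  proof -
    have "k = 0 \<or> k = 1 \<or> k = 2 \<or> k = 3 \<or> k = 4 \<or> k = 5" using that by linarith
    then show "?A ! k = (s k)^2 * ?Q ! k" "?Q ! k = (s k)^2 * ?A ! k"
      using i by (auto simp: s_def albert_def power2_eq_square)
  qed
  have len: "length q = 6" using iso by (simp add: qf_isometric_def)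
  obtain f where f: "frame q ?Q f" using iso by (rule qf_isometric_frameE)
  obtain f' where f': "frame ?Q q f'" using qf_isometric_sym[OF iso] by (rule qf_isometric_frameE)
  obtain g where g: "frame ?Q ?A g" using frame_rescale[of ?A ?Q s, OF _ s(1)] by auto
  obtain g' where g': "frame ?A ?Q g'" using frame_rescale[of ?Q ?A s, OF _ s(2)] by auto
  obtain h where h: "frame q ?A h" using frame_trans[OF f g] by blast
  obtain h' where h': "frame ?A q h'" using frame_trans[OF g' f'] by blast
  have anisoA: "anisotropic ?A"
    by (rule anisotropic_of_frame[OF h aniso]) (use nz in \<open>simp add: albert_def\<close>)
  have aniso': "anisotropic ?q" by (rule anisotropic_scale_qf[OF aniso lam])
  define rep where "rep n \<longleftrightarrow> (\<exists>ps. length ps = n \<and> (\<forall>(x, y)\<in>set ps. x \<noteq> 0 \<and> y \<noteq> 0) \<and>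
    witt_equiv ?q (concat (map (\<lambda>(x, y). pfister2 x y) ps)))" for n
  have Pf2: "Pf2 ?q = (LEAST n. rep n)" by (simp add: Pf2_def rep_def)
  obtain n where "rep n"
    using exists_pfister_sum[OF char i nz lam _ frame_scale_qf[OF f, of lam]] len
    unfolding rep_def by auto
  then have least: "rep (Pf2 ?q)" unfolding Pf2 by (rule LeastI)
  \<comment> \<open>Sums of no or one Pfister form have dimension 0 or 4, less than the dimension 6
    of the anisotropic form.\<close>
  have two_le: "2 \<le> n" if n: "rep n" for n
  proof (rule ccontr)
    assume "\<not> 2 \<le> n"
    obtain ps where "length ps = n" "witt_equiv ?q (concat (map (\<lambda>(x, y). pfister2 x y) ps))"
      using n unfolding rep_def by blast
    moreover have "length (concat (map (\<lambda>(x, y). pfister2 x y) ps)) = 4 * length ps" for ps :: "('a \<times> 'a) list"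
      by (induction ps) (auto simp: pfister2_def)
    ultimately show False
      using not_witt_equiv_smaller[OF char aniso', of "concat (map (\<lambda>(x, y). pfister2 x y) ps)"] \<open>\<not> 2 \<le> n\<close>
      by (simp add: len)
  qed
  have "Pf2 ?q = 2 \<longleftrightarrow> rep 2"
  proof
    show "rep 2" if "Pf2 ?q = 2" using least by (simp add: that)
    show "Pf2 ?q = 2" if "rep 2" unfolding Pf2 by (rule Least_equality[where P = rep, OF that two_le])
  qed
  also have "\<dots> \<longleftrightarrow> (\<exists>x y z w. x \<noteq> 0 \<and> y \<noteq> 0 \<and> z \<noteq> 0 \<and> w \<noteq> 0 \<and> witt_equiv ?q (pfister2 x y @ pfister2 z w))"
  proof
    assume "rep 2"
    then obtain ps where ps: "length ps = 2" "\<forall>(x, y)\<in>set ps. x \<noteq> 0 \<and> y \<noteq> 0"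
      "witt_equiv ?q (concat (map (\<lambda>(x, y). pfister2 x y) ps))" unfolding rep_def by blast
    then obtain x y z w where "ps = [(x, y), (z, w)]"
      by (auto simp: length_Suc_conv numeral_2_eq_2)
    with ps show "\<exists>x y z w. x \<noteq> 0 \<and> y \<noteq> 0 \<and> z \<noteq> 0 \<and> w \<noteq> 0 \<and> witt_equiv ?q (pfister2 x y @ pfister2 z w)"
      by simp blast
  next
    assume "\<exists>x y z w. x \<noteq> 0 \<and> y \<noteq> 0 \<and> z \<noteq> 0 \<and> w \<noteq> 0 \<and> witt_equiv ?q (pfister2 x y @ pfister2 z w)"
    then obtain x y z w where "x \<noteq> 0" "y \<noteq> 0" "z \<noteq> 0" "w \<noteq> 0" "witt_equiv ?q (pfister2 x y @ pfister2 z w)"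
      by blast
    then show "rep 2" unfolding rep_def by (intro exI[of _ "[(x, y), (z, w)]"]) simp
  qed
  also have "\<dots> \<longleftrightarrow> (\<exists>x y z w. x \<noteq> 0 \<and> y \<noteq> 0 \<and> z \<noteq> 0 \<and> w \<noteq> 0 \<and> (\<exists>f. frame ?q [x, y, x * y, z, w, z * w] f))"
    using frame_six_iff_witt_equiv[OF char i, of ?q] by (simp add: len cong: conj_cong)
  also have "\<dots> \<longleftrightarrow> (\<exists>u \<in> bq_Sym. lam ^ 2 = bq_Nrd a b c d u)"
  proof
    assume "\<exists>x y z w. x \<noteq> 0 \<and> y \<noteq> 0 \<and> z \<noteq> 0 \<and> w \<noteq> 0 \<and> (\<exists>f. frame ?q [x, y, x * y, z, w, z * w] f)"
    then obtain x y z w e where xy: "x \<noteq> 0" "y \<noteq> 0" and e: "frame ?q [x, y, x * y, z, w, z * w] e" by blast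
    obtain v where v: "frame (scale_qf lam ?A) [x, y, x * y, z, w, z * w] v"
      using frame_trans[OF frame_scale_qf[OF h'] e] by blast
    let ?B = "bil ?A"
    have "lam * ?B (v j) (v k) = (if j = k then [x, y, x * y] ! j else 0)" if "j < 3" "k < 3" for j k
      using frameD[OF v, of j k] that less_3_cases[OF that(1)] by (auto simp: bil_scale_qf)
    from this[of 0 0] this[of 1 1] this[of 2 2] this[of 0 1] this[of 0 2] this[of 1 2]
    have v: "?B (v 0) (v 0) = x / lam" "?B (v 1) (v 1) = y / lam" "?B (v 2) (v 2) = x * y / lam"
      and orth: "?B (v 0) (v 1) = 0" "?B (v 0) (v 2) = 0" "?B (v 1) (v 2) = 0"
      using lam by (auto simp: nonzero_eq_divide_eq mult.commute)
    \<comment> \<open>The three values have product (xy)^2 / \<lambda>^3, so the triple product has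
      reduced norm (xy)^4 / \<lambda>^6. The scalar \<lambda>^2 / (xy) contributes its fourth power
      \<lambda>^8 / (xy)^4, which leaves \<lambda>^2.\<close>
    obtain u where u: "u \<in> bq_Sym" and "bq_Nrd a b c d u
        = (lam^2 / (x * y))^4 * (x / lam * (y / lam) * (x * y / lam))^2"
      using exists_sym_nrd[OF char nz orth, of "lam^2 / (x * y)"] unfolding v by blast
    note this(2)
    also have "(lam^2 / (x * y))^4 * (x / lam * (y / lam) * (x * y / lam))^2 = lam^2"
    proof -
      have "x / lam * (y / lam) * (x * y / lam) = (x * y)^2 / lam^3"
        by (simp add: power2_eq_square power3_eq_cube)
      then show ?thesis using xy lam by (simp add: power_divide flip: power_mult power_diff)
    qed
    finally show "\<exists>u \<in> bq_Sym. lam ^ 2 = bq_Nrd a b c d u" using u by (intro bexI[of _ u]) simp_all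
  next
    assume "\<exists>u \<in> bq_Sym. lam ^ 2 = bq_Nrd a b c d u"
    then obtain u where "lam^2 = sym_nrd a b c d u" using bq_Nrd_sym[OF char nz] by auto
    from frame_of_sym_nrd[OF char i nz anisoA lam this]
    obtain x y z w e where "x \<noteq> 0" "y \<noteq> 0" "z \<noteq> 0" "w \<noteq> 0"
      and e: "frame (scale_qf lam ?A) [x, y, x * y, z, w, z * w] e" .
    moreover have "\<exists>f. frame ?q [x, y, x * y, z, w, z * w] f"
      using frame_trans[OF frame_scale_qf[OF h] e] by blast
    ultimately show "\<exists>x y z w. x \<noteq> 0 \<and> y \<noteq> 0 \<and> z \<noteq> 0 \<and> w \<noteq> 0 \<and> (\<exists>f. frame ?q [x, y, x * y, z, w, z * w] f)"
      by blast
  qed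
  finally show ?thesis .
qed

end
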